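(* Let $\mathcal{A}$ be an additive category. The functor $\mathcal{F}:\mathcal{P}(\mathcal{A})\to\mathrm{Com}^-(\mathcal{A})$ and the inclusion of $\mathrm{Com}^-(\mathcal{A})$ into $\mathcal{P}(\mathcal{A})$ form a pair of mutually quasi-inverse equivalences of categories.
   Context: **Indices.** $\mathbb{I}$ is the abelian group of all $\mathbf{a}=(a_i)_{i\in\mathbb{N}}$ with $a_i\in\mathbb{Z}$ and $a_i=0$ for $i\gg0$ ($\mathbb{N}=\{1,2,\dots\}$); $\varepsilon_i\in\mathbb{I}$ is the $i$-th standard basis vector; $\mathrm{ht}(\mathbf{a})=\sum_i a_i$; $\mathbb{I}_k=\{\mathbf{a}\in\mathbb{I}:\mathrm{ht}(\mathbf{a})=k\}$. **Pyramids.** A pyramid $(X_\bullet,d_\bullet,n)$ over $\mathcal{A}$ consists of $n\in\mathbb{Z}_{\geq0}$, objects $X_{\mathbf{a}}$ of $\mathcal{A}$ ($\mathbf{a}\in\mathbb{I}$) and morphisms $d_{\mathbf{a},i}:X_{\mathbf{a}}\to X_{\mathbf{a}+\varepsilon_i}$ ($i\in\mathbb{N}$) such that: (I) $X_{\mathbf{a}}=0$ unless $a_i=0$ for all $i>n$; (II) there is $m\in\mathbb{Z}$ with $X_{\mathbf{a}}=0$ unless all $a_i<m$; (III) $d_{\mathbf{a}+\varepsilon_i,i}\circ d_{\mathbf{a},i}=0$; (IV) $d_{\mathbf{a}+\varepsilon_i,j}\circ d_{\mathbf{a},i}=-d_{\mathbf{a}+\varepsilon_j,i}\circ d_{\mathbf{a},j}$.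 Let $d^{(k)}$ be the matrix with rows indexed by $\mathbf{a}\in\mathbb{I}_{k+1}$, columns by $\mathbf{b}\in\mathbb{I}_k$, and entries $d^{(k)}_{\mathbf{a},\mathbf{b}}=d_{\mathbf{b},i}$ if $\mathbf{a}=\mathbf{b}+\varepsilon_i$, and $0$ otherwise. A morphism $\alpha:(X_\bullet,d_\bullet,n)\to(Y_\bullet,\partial_\bullet,m)$ is a family of matrices $\alpha^{(k)}=(\alpha^{(k)}_{\mathbf{a},\mathbf{b}})_{\mathbf{a},\mathbf{b}\in\mathbb{I}_k}$, $k\in\mathbb{Z}$, with $\alpha^{(k)}_{\mathbf{a},\mathbf{b}}:X_{\mathbf{b}}\to Y_{\mathbf{a}}$, such that $\alpha^{(k+1)}\cdot d^{(k)}=\partial^{(k)}\cdot\alpha^{(k)}$ for all $k$. Composition is matrix multiplication for each $k$; identity morphisms are given by identity matrices. This gives the category $\mathcal{P}(\mathcal{A})$. **Complexes.** $\mathrm{Com}^-(\mathcal{A})$ is the category of bounded from the right (cochain) complexes $\cdots\to M_{k-1}\xrightarrow{f_{k-1}}M_k\xrightarrow{f_k}M_{k+1}\to\cdots$ over $\mathcal{A}$ (so $M_k=0$ for $k\gg0$). The inclusion $\mathrm{Com}^-(\mathcal{A})\to\mathcal{P}(\mathcal{A})$ sends such a complex to the pyramid $(X_\bullet,d_\bullet,1)$ with $X_{k\varepsilon_1}=M_k$, all other $X_{\mathbf{a}}=0$, $d_{k\varepsilon_1,1}=f_k$ and all other $d_{\mathbf{a},i}=0$, with the obvious assignment on morphisms.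 The functor $\mathcal{F}$ sends a pyramid $(X_\bullet,d_\bullet,n)$ to the complex with $M_k=\bigoplus_{\mathrm{ht}(\mathbf{a})=k}X_{\mathbf{a}}$ (which has only finitely many non-zero summands) and $f_k=d^{(k)}$, and sends a morphism $\alpha$ to the morphism of complexes whose $k$-th component is given by the matrix $\alpha^{(k)}$ acting on these direct sums. *)

theory Defs
  imports "HOL-Algebra.FiniteProduct" "HOL-Library.Poly_Mapping"
begin

section \<open>Categories, functors, quasi-inverse equivalences\<close>

text \<open>
  Hom-sets are indexed by source and target and need not be disjoint; accordingly composition and
  the action of a functor on morphisms take the objects involved as arguments.
  For \<open>f : x \<rightarrow> y\<close> and \<open>g : y \<rightarrow> z\<close> the composite \<open>g \<circ> f\<close> is \<open>Cmp C x y z g f\<close>.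
\<close>

record ('o, 'm) cat =
  Obj :: "'o set"
  Hom :: "'o \<Rightarrow> 'o \<Rightarrow> 'm set"
  Cmp :: "'o \<Rightarrow> 'o \<Rightarrow> 'o \<Rightarrow> 'm \<Rightarrow> 'm \<Rightarrow> 'm"
  Idn :: "'o \<Rightarrow> 'm"

locale category =
  fixes C :: "('o, 'm, 'e) cat_scheme"
  assumes Idn_in_Hom: "x \<in> Obj C \<Longrightarrow> Idn C x \<in> Hom C x x"
    and Cmp_in_Hom: "\<lbrakk>x \<in> Obj C; y \<in> Obj C; z \<in> Obj C; f \<in> Hom C x y; g \<in> Hom C y z\<rbrakk>
          \<Longrightarrow> Cmp C x y z g f \<in> Hom C x z"
    and Cmp_Idn_left: "\<lbrakk>x \<in> Obj C; y \<in> Obj C; f \<in> Hom C x y\<rbrakk>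
          \<Longrightarrow> Cmp C x y y (Idn C y) f = f"
    and Cmp_Idn_right: "\<lbrakk>x \<in> Obj C; y \<in> Obj C; f \<in> Hom C x y\<rbrakk>
          \<Longrightarrow> Cmp C x x y f (Idn C x) = f"
    and Cmp_assoc: "\<lbrakk>w \<in> Obj C; x \<in> Obj C; y \<in> Obj C; z \<in> Obj C;
            f \<in> Hom C w x; g \<in> Hom C x y; h \<in> Hom C y z\<rbrakk>
          \<Longrightarrow> Cmp C w y z h (Cmp C w x y g f) = Cmp C w x z (Cmp C x y z h g) f"

definition is_iso :: "('o, 'm, 'e) cat_scheme \<Rightarrow> 'o \<Rightarrow> 'o \<Rightarrow> 'm \<Rightarrow> bool" where
  "is_iso C x y f \<longleftrightarrow> f \<in> Hom C x y \<and>
     (\<exists>g \<in> Hom C y x. Cmp C x y x g f = Idn C x \<and> Cmp C y x y f g = Idn C y)"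

record ('o1, 'm1, 'o2, 'm2) funct =
  ObjMap :: "'o1 \<Rightarrow> 'o2"
  MorMap :: "'o1 \<Rightarrow> 'o1 \<Rightarrow> 'm1 \<Rightarrow> 'm2"

definition is_functor ::
  "('o1, 'm1, 'e1) cat_scheme \<Rightarrow> ('o2, 'm2, 'e2) cat_scheme \<Rightarrow> ('o1, 'm1, 'o2, 'm2) funct \<Rightarrow> bool" where
  "is_functor C D F \<longleftrightarrow>
     (\<forall>x \<in> Obj C. ObjMap F x \<in> Obj D) \<and>
     (\<forall>x \<in> Obj C. \<forall>y \<in> Obj C. \<forall>f \<in> Hom C x y.
        MorMap F x y f \<in> Hom D (ObjMap F x) (ObjMap F y)) \<and>
     (\<forall>x \<in> Obj C. MorMap F x x (Idn C x) = Idn D (ObjMap F x)) \<and>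
     (\<forall>x \<in> Obj C. \<forall>y \<in> Obj C. \<forall>z \<in> Obj C. \<forall>f \<in> Hom C x y. \<forall>g \<in> Hom C y z.
        MorMap F x z (Cmp C x y z g f) =
          Cmp D (ObjMap F x) (ObjMap F y) (ObjMap F z) (MorMap F y z g) (MorMap F x y f))"

definition id_functor :: "('o, 'm, 'o, 'm) funct" where
  "id_functor = \<lparr>ObjMap = (\<lambda>x. x), MorMap = (\<lambda>x y f. f)\<rparr>"

definition comp_functor ::
  "('o2, 'm2, 'o3, 'm3) funct \<Rightarrow> ('o1, 'm1, 'o2, 'm2) funct \<Rightarrow> ('o1, 'm1, 'o3, 'm3) funct" where
  "comp_functor G F =
     \<lparr>ObjMap = (\<lambda>x. ObjMap G (ObjMap F x)),
      MorMap = (\<lambda>x y f. MorMap G (ObjMap F x) (ObjMap F y) (MorMap F x y f))\<rparr>"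

definition natural_iso ::
  "('o1, 'm1, 'e1) cat_scheme \<Rightarrow> ('o2, 'm2, 'e2) cat_scheme \<Rightarrow>
   ('o1, 'm1, 'o2, 'm2) funct \<Rightarrow> ('o1, 'm1, 'o2, 'm2) funct \<Rightarrow> ('o1 \<Rightarrow> 'm2) \<Rightarrow> bool" where
  "natural_iso C D F G \<eta> \<longleftrightarrow>
     (\<forall>x \<in> Obj C. is_iso D (ObjMap F x) (ObjMap G x) (\<eta> x)) \<and>
     (\<forall>x \<in> Obj C. \<forall>y \<in> Obj C. \<forall>f \<in> Hom C x y.
        Cmp D (ObjMap F x) (ObjMap F y) (ObjMap G y) (\<eta> y) (MorMap F x y f) =
        Cmp D (ObjMap F x) (ObjMap G x) (ObjMap G y) (MorMap G x y f) (\<eta> x))"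

definition quasi_inverse_equivalences ::
  "('o1, 'm1, 'e1) cat_scheme \<Rightarrow> ('o2, 'm2, 'e2) cat_scheme \<Rightarrow>
   ('o1, 'm1, 'o2, 'm2) funct \<Rightarrow> ('o2, 'm2, 'o1, 'm1) funct \<Rightarrow> bool" where
  "quasi_inverse_equivalences C D F G \<longleftrightarrow>
     category C \<and> category D \<and> is_functor C D F \<and> is_functor D C G \<and>
     (\<exists>\<eta>. natural_iso C C id_functor (comp_functor G F) \<eta>) \<and>
     (\<exists>\<epsilon>. natural_iso D D (comp_functor F G) id_functor \<epsilon>)"


section \<open>Additive categories\<close>

record ('o, 'm) precat = "('o, 'm) cat" +
  hadd :: "'o \<Rightarrow> 'o \<Rightarrow> 'm \<Rightarrow> 'm \<Rightarrow> 'm"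
  hzero :: "'o \<Rightarrow> 'o \<Rightarrow> 'm"

text \<open>
  The abelian group of morphisms from \<open>x\<close> to \<open>y\<close>, in the multiplicative notation of
  \<^theory>\<open>HOL-Algebra.Group\<close>: \<open>inv\<close> is negation and \<^const>\<open>finprod\<close> is finite summation.
\<close>

definition HomG :: "('o, 'm, 'e) precat_scheme \<Rightarrow> 'o \<Rightarrow> 'o \<Rightarrow> 'm monoid" where
  "HomG A x y = \<lparr>carrier = Hom A x y, mult = hadd A x y, one = hzero A x y\<rparr>"

definition is_zero_object :: "('o, 'm, 'e) cat_scheme \<Rightarrow> 'o \<Rightarrow> bool" where
  "is_zero_object A z \<longleftrightarrow>
     z \<in> Obj A \<and> (\<forall>x \<in> Obj A. (\<exists>!f. f \<in> Hom A z x) \<and> (\<exists>!f. f \<in> Hom A x z))"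

locale preadditive_category = category A
  for A :: "('o, 'm, 'e) precat_scheme" +
  assumes HomG_comm_group: "\<lbrakk>x \<in> Obj A; y \<in> Obj A\<rbrakk> \<Longrightarrow> comm_group (HomG A x y)"
    and Cmp_hadd_left: "\<lbrakk>x \<in> Obj A; y \<in> Obj A; z \<in> Obj A;
            f \<in> Hom A x y; g \<in> Hom A y z; g' \<in> Hom A y z\<rbrakk>
          \<Longrightarrow> Cmp A x y z (hadd A y z g g') f = hadd A x z (Cmp A x y z g f) (Cmp A x y z g' f)"
    and Cmp_hadd_right: "\<lbrakk>x \<in> Obj A; y \<in> Obj A; z \<in> Obj A;
            f \<in> Hom A x y; f' \<in> Hom A x y; g \<in> Hom A y z\<rbrakk>
          \<Longrightarrow> Cmp A x y z g (hadd A x y f f') = hadd A x z (Cmp A x y z g f) (Cmp A x y z g f')"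

locale additive_category = preadditive_category A
  for A :: "('o, 'm, 'e) precat_scheme" +
  assumes ex_zero_object: "\<exists>z. is_zero_object A z"
    and ex_biproduct: "\<lbrakk>x \<in> Obj A; y \<in> Obj A\<rbrakk> \<Longrightarrow>
          \<exists>s \<in> Obj A. \<exists>i1 \<in> Hom A x s. \<exists>i2 \<in> Hom A y s. \<exists>p1 \<in> Hom A s x. \<exists>p2 \<in> Hom A s y.
            Cmp A x s x p1 i1 = Idn A x \<and> Cmp A y s y p2 i2 = Idn A y \<and>
            Cmp A y s x p1 i2 = hzero A y x \<and> Cmp A x s y p2 i1 = hzero A x y \<and>
            hadd A s s (Cmp A s x s i1 p1) (Cmp A s y s i2 p2) = Idn A s"

definition zero_obj :: "('o, 'm, 'e) precat_scheme \<Rightarrow> 'o" where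
  "zero_obj A = (SOME z. is_zero_object A z)"

text \<open>
  The sum of a family of morphisms \<open>x \<rightarrow> y\<close> with finitely many non-zero members. Restricting to
  the support matters: \<^const>\<open>finprod\<close> over an infinite index set is the neutral element.
\<close>

definition hsum :: "('o, 'm, 'e) precat_scheme \<Rightarrow> 'o \<Rightarrow> 'o \<Rightarrow> ('i \<Rightarrow> 'm) \<Rightarrow> 'i set \<Rightarrow> 'm" where
  "hsum A x y f J = finprod (HomG A x y) f {j \<in> J. f j \<noteq> hzero A x y}"

text \<open>
  A direct sum of a family \<open>(X\<^sub>j)\<close>, \<open>j \<in> J\<close>, of objects only finitely many of which are non-zero,
  with its injections \<open>\<iota>\<close> and projections \<open>\<pi>\<close>.
\<close>

definition is_direct_sum ::
  "('o, 'm, 'e) precat_scheme \<Rightarrow> 'i set \<Rightarrow> ('i \<Rightarrow> 'o) \<Rightarrow> 'o \<Rightarrow> ('i \<Rightarrow> 'm) \<Rightarrow> ('i \<Rightarrow> 'm) \<Rightarrow> bool" where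
  "is_direct_sum A J X S \<iota> \<pi> \<longleftrightarrow>
     S \<in> Obj A \<and> (\<forall>j \<in> J. X j \<in> Obj A) \<and> finite {j \<in> J. \<not> is_zero_object A (X j)} \<and>
     (\<forall>j \<in> J. \<iota> j \<in> Hom A (X j) S \<and> \<pi> j \<in> Hom A S (X j)) \<and>
     (\<forall>i \<in> J. \<forall>j \<in> J. Cmp A (X j) S (X i) (\<pi> i) (\<iota> j) =
        (if i = j then Idn A (X j) else hzero A (X j) (X i))) \<and>
     hsum A S S (\<lambda>j. Cmp A S (X j) S (\<iota> j) (\<pi> j)) J = Idn A S"

definition direct_sum ::
  "('o, 'm, 'e) precat_scheme \<Rightarrow> 'i set \<Rightarrow> ('i \<Rightarrow> 'o) \<Rightarrow> 'o \<times> ('i \<Rightarrow> 'm) \<times> ('i \<Rightarrow> 'm)" where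
  "direct_sum A J X = (SOME (S, \<iota>, \<pi>). is_direct_sum A J X S \<iota> \<pi>)"

definition ds_obj :: "('o, 'm, 'e) precat_scheme \<Rightarrow> 'i set \<Rightarrow> ('i \<Rightarrow> 'o) \<Rightarrow> 'o" where
  "ds_obj A J X = fst (direct_sum A J X)"

definition ds_inj :: "('o, 'm, 'e) precat_scheme \<Rightarrow> 'i set \<Rightarrow> ('i \<Rightarrow> 'o) \<Rightarrow> 'i \<Rightarrow> 'm" where
  "ds_inj A J X = fst (snd (direct_sum A J X))"

definition ds_proj :: "('o, 'm, 'e) precat_scheme \<Rightarrow> 'i set \<Rightarrow> ('i \<Rightarrow> 'o) \<Rightarrow> 'i \<Rightarrow> 'm" where
  "ds_proj A J X = snd (snd (direct_sum A J X))"

text \<open>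
  A matrix of morphisms \<open>\<alpha> i j : X\<^sub>j \<rightarrow> Y\<^sub>i\<close> (rows \<open>i \<in> I\<close>, columns \<open>j \<in> J\<close>), acting as a
  morphism of direct sums.
\<close>

definition mat_mor ::
  "('o, 'm, 'e) precat_scheme \<Rightarrow> 'j set \<Rightarrow> ('j \<Rightarrow> 'o) \<Rightarrow> 'i set \<Rightarrow> ('i \<Rightarrow> 'o) \<Rightarrow> ('i \<Rightarrow> 'j \<Rightarrow> 'm) \<Rightarrow> 'm" where
  "mat_mor A J X I Y \<alpha> =
     (let S = ds_obj A J X; T = ds_obj A I Y in
      hsum A S T
        (\<lambda>(i, j). Cmp A S (Y i) T (ds_inj A I Y i) (Cmp A S (X j) (Y i) (\<alpha> i j) (ds_proj A J X j)))
        (I \<times> J))"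

text \<open>
  The product \<open>\<beta> \<cdot> \<alpha>\<close> of matrices \<open>\<alpha> c b : X\<^sub>b \<rightarrow> Y\<^sub>c\<close> and \<open>\<beta> a c : Y\<^sub>c \<rightarrow> Z\<^sub>a\<close>, the inner index
  \<open>c\<close> running over \<open>J\<close>.
\<close>

definition mat_mult ::
  "('o, 'm, 'e) precat_scheme \<Rightarrow> 'c set \<Rightarrow> ('b \<Rightarrow> 'o) \<Rightarrow> ('c \<Rightarrow> 'o) \<Rightarrow> ('a \<Rightarrow> 'o) \<Rightarrow>
   ('a \<Rightarrow> 'c \<Rightarrow> 'm) \<Rightarrow> ('c \<Rightarrow> 'b \<Rightarrow> 'm) \<Rightarrow> 'a \<Rightarrow> 'b \<Rightarrow> 'm" where
  "mat_mult A J X Y Z \<beta> \<alpha> a b =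
     hsum A (X b) (Z a) (\<lambda>c. Cmp A (X b) (Y c) (Z a) (\<beta> a c) (\<alpha> c b)) J"


section \<open>Complexes bounded from the right\<close>

record ('o, 'm) complx =
  cobj :: "int \<Rightarrow> 'o"
  cdiff :: "int \<Rightarrow> 'm"

definition is_complex :: "('o, 'm, 'e) precat_scheme \<Rightarrow> ('o, 'm) complx \<Rightarrow> bool" where
  "is_complex A M \<longleftrightarrow>
     (\<forall>k. cobj M k \<in> Obj A) \<and>
     (\<forall>k. cdiff M k \<in> Hom A (cobj M k) (cobj M (k + 1))) \<and>
     (\<forall>k. Cmp A (cobj M k) (cobj M (k + 1)) (cobj M (k + 2)) (cdiff M (k + 1)) (cdiff M k) =
        hzero A (cobj M k) (cobj M (k + 2)))"

definition Com_minus :: "('o, 'm, 'e) precat_scheme \<Rightarrow> (('o, 'm) complx, int \<Rightarrow> 'm) cat" where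
  "Com_minus A =
     \<lparr>Obj = {M. is_complex A M \<and> (\<exists>K. \<forall>k \<ge> K. is_zero_object A (cobj M k))},
      Hom = (\<lambda>M N. {g. (\<forall>k. g k \<in> Hom A (cobj M k) (cobj N k)) \<and>
        (\<forall>k. Cmp A (cobj M k) (cobj M (k + 1)) (cobj N (k + 1)) (g (k + 1)) (cdiff M k) =
             Cmp A (cobj M k) (cobj N k) (cobj N (k + 1)) (cdiff N k) (g k))}),
      Cmp = (\<lambda>M N L h g k. Cmp A (cobj M k) (cobj N k) (cobj L k) (h k) (g k)),
      Idn = (\<lambda>M k. Idn A (cobj M k))\<rparr>"


section \<open>Pyramids\<close>

text \<open>
  Index vectors are finitely supported functions from \<^typ>\<open>nat\<close> to \<^typ>\<open>int\<close>. Coordinates are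
  counted from \<open>0\<close>: position \<open>i\<close> here is position \<open>i + 1\<close> in the numbering by \<open>{1, 2, \<dots>}\<close>. So
  \<open>\<epsilon>\<^sub>1\<close> is \<open>eps 0\<close>, and ``\<open>a\<^sub>i = 0\<close> for all \<open>i > n\<close>'' becomes ``\<open>lookup a i = 0\<close> for all \<open>i \<ge> n\<close>''.
\<close>

type_synonym idx = "nat \<Rightarrow>\<^sub>0 int"

definition eps :: "nat \<Rightarrow> idx" where
  "eps i = Poly_Mapping.single i 1"

definition ht :: "idx \<Rightarrow> int" where
  "ht a = (\<Sum>i \<in> Poly_Mapping.keys a. Poly_Mapping.lookup a i)"

definition Idx :: "int \<Rightarrow> idx set" where
  "Idx k = {a. ht a = k}"

record ('o, 'm) pyramid =
  pobj :: "idx \<Rightarrow> 'o"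
  pdiff :: "idx \<Rightarrow> nat \<Rightarrow> 'm"
  pdim :: nat

definition is_pyramid :: "('o, 'm, 'e) precat_scheme \<Rightarrow> ('o, 'm) pyramid \<Rightarrow> bool" where
  "is_pyramid A P \<longleftrightarrow> (let X = pobj P; d = pdiff P in
     (\<forall>a. X a \<in> Obj A) \<and>
     (\<forall>a i. d a i \<in> Hom A (X a) (X (a + eps i))) \<and>
     (\<forall>a. \<not> (\<forall>i \<ge> pdim P. Poly_Mapping.lookup a i = 0) \<longrightarrow> is_zero_object A (X a)) \<and>
     (\<exists>m. \<forall>a. \<not> (\<forall>i. Poly_Mapping.lookup a i < m) \<longrightarrow> is_zero_object A (X a)) \<and>
     (\<forall>a i. Cmp A (X a) (X (a + eps i)) (X (a + eps i + eps i)) (d (a + eps i) i) (d a i) =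
        hzero A (X a) (X (a + eps i + eps i))) \<and>
     (\<forall>a i j. Cmp A (X a) (X (a + eps i)) (X (a + eps i + eps j)) (d (a + eps i) j) (d a i) =
        inv\<^bsub>HomG A (X a) (X (a + eps i + eps j))\<^esub>
          (Cmp A (X a) (X (a + eps j)) (X (a + eps j + eps i)) (d (a + eps j) i) (d a j))))"

definition pmat :: "('o, 'm, 'e) precat_scheme \<Rightarrow> ('o, 'm) pyramid \<Rightarrow> idx \<Rightarrow> idx \<Rightarrow> 'm" where
  "pmat A P a b =
     (if \<exists>i. a = b + eps i then pdiff P b (THE i. a = b + eps i)
      else hzero A (pobj P b) (pobj P a))"

text \<open>
  A morphism is a family \<open>\<alpha> k a b\<close> that is only meaningful for \<open>a, b \<in> Idx k\<close>; it is \<open>undefined\<close>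
  elsewhere, so that equality of functions is equality of families of matrices.
\<close>

definition pyr_ext :: "(int \<Rightarrow> idx \<Rightarrow> idx \<Rightarrow> 'm) \<Rightarrow> int \<Rightarrow> idx \<Rightarrow> idx \<Rightarrow> 'm" where
  "pyr_ext \<alpha> k a b = (if a \<in> Idx k \<and> b \<in> Idx k then \<alpha> k a b else undefined)"

definition Pyr ::
  "('o, 'm, 'e) precat_scheme \<Rightarrow> (('o, 'm) pyramid, int \<Rightarrow> idx \<Rightarrow> idx \<Rightarrow> 'm) cat" where
  "Pyr A =
     \<lparr>Obj = {P. is_pyramid A P},
      Hom = (\<lambda>P Q. {\<alpha>. pyr_ext \<alpha> = \<alpha> \<and>
        (\<forall>k. \<forall>a \<in> Idx k. \<forall>b \<in> Idx k. \<alpha> k a b \<in> Hom A (pobj P b) (pobj Q a)) \<and>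
        (\<forall>k. \<forall>a \<in> Idx (k + 1). \<forall>b \<in> Idx k.
           mat_mult A (Idx (k + 1)) (pobj P) (pobj P) (pobj Q) (\<alpha> (k + 1)) (pmat A P) a b =
           mat_mult A (Idx k) (pobj P) (pobj Q) (pobj Q) (pmat A Q) (\<alpha> k) a b)}),
      Cmp = (\<lambda>P Q R \<beta> \<alpha>. pyr_ext
        (\<lambda>k. mat_mult A (Idx k) (pobj P) (pobj Q) (pobj R) (\<beta> k) (\<alpha> k))),
      Idn = (\<lambda>P. pyr_ext
        (\<lambda>k a b. if a = b then Idn A (pobj P a) else hzero A (pobj P b) (pobj P a)))\<rparr>"


section \<open>The inclusion and the functor to complexes\<close>

text \<open>\<open>a = k \<epsilon>\<^sub>1\<close> for some \<open>k\<close> iff it holds for \<open>k = ht a\<close>.\<close>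

definition axis :: "int \<Rightarrow> idx" where
  "axis k = Poly_Mapping.single 0 k"

definition incl_obj :: "('o, 'm, 'e) precat_scheme \<Rightarrow> ('o, 'm) complx \<Rightarrow> idx \<Rightarrow> 'o" where
  "incl_obj A M a = (if a = axis (ht a) then cobj M (ht a) else zero_obj A)"

definition Incl ::
  "('o, 'm, 'e) precat_scheme \<Rightarrow>
   (('o, 'm) complx, int \<Rightarrow> 'm, ('o, 'm) pyramid, int \<Rightarrow> idx \<Rightarrow> idx \<Rightarrow> 'm) funct" where
  "Incl A =
     \<lparr>ObjMap = (\<lambda>M.
        \<lparr>pobj = incl_obj A M,
         pdiff = (\<lambda>a i. if a = axis (ht a) \<and> i = 0 then cdiff M (ht a)
           else hzero A (incl_obj A M a) (incl_obj A M (a + eps i))),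
         pdim = 1\<rparr>),
      MorMap = (\<lambda>M N g. pyr_ext
        (\<lambda>k a b. if a = axis k \<and> b = axis k then g k
           else hzero A (incl_obj A M b) (incl_obj A N a)))\<rparr>"

definition FTot ::
  "('o, 'm, 'e) precat_scheme \<Rightarrow>
   (('o, 'm) pyramid, int \<Rightarrow> idx \<Rightarrow> idx \<Rightarrow> 'm, ('o, 'm) complx, int \<Rightarrow> 'm) funct" where
  "FTot A =
     \<lparr>ObjMap = (\<lambda>P.
        \<lparr>cobj = (\<lambda>k. ds_obj A (Idx k) (pobj P)),
         cdiff = (\<lambda>k. mat_mor A (Idx k) (pobj P) (Idx (k + 1)) (pobj P) (pmat A P))\<rparr>),
      MorMap = (\<lambda>P Q \<alpha> k. mat_mor A (Idx k) (pobj P) (Idx k) (pobj Q) (\<alpha> k))\<rparr>"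

end

theory Submission
  imports Defs
begin

text \<open>
  The total complex functor \<open>F\<close> is fully faithful: a morphism between finite direct sums is the same
  thing as its matrix of components (\<open>mat_mor_entry\<close>, \<open>mat_eqI\<close>), and a family of matrices commutes
  with the differentials of two pyramids iff the corresponding morphisms commute with the
  differentials of the total complexes (\<open>in_Hom_Pyr_iff\<close>, \<open>FTot_Hom_bij\<close>). The differentials of
  the total complex compose to zero because those of a pyramid anticommute and have square zero
  (\<open>pmat_square\<close>); it is
  bounded from the right because, for a pyramid of dimension \<open>n\<close>, the object at \<open>a\<close> is non-zero only
  if all but the first \<open>n\<close> coordinates of \<open>a\<close> vanish and all are below a common bound. If \<open>I\<close> denotes the inclusion, the total complex \<open>F I M\<close> of a complex \<open>M\<close>
  is, in degree \<open>k\<close>, a direct sum of \<open>M\<^sub>k\<close> and zero objects, so the projections to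
  these summands form a natural isomorphism \<open>F I \<rightarrow> id\<close> (\<open>FTot_Incl_natural_iso\<close>).

  The rest is formal (\<open>quasi_inverse_equivalencesI\<close>). Since \<open>F\<close> is fully faithful and respects
  identities and composition, the axioms of a category for pyramids and the functoriality of \<open>I\<close>
  are inherited from complexes, and the isomorphism \<open>id \<rightarrow> I F\<close> is obtained by lifting the inverse
  of \<open>F I F P \<rightarrow> F P\<close> along \<open>F\<close>. In particular, associativity of the product of matrices never has
  to be checked on double sums: an entry of a product of matrices is a component of a composite of
  morphisms of direct sums (\<open>mat_mult_eq_entry\<close>).
\<close>

section \<open>Equivalences from fully faithful functors\<close>

text \<open>
  Only \<open>D\<close> is assumed to be a category; of \<open>C\<close> it suffices that identities and composites lie in the
  expected Hom-sets, and \<open>G\<close> need not be known to respect identities and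
  composition: as \<open>F\<close> is bijective on Hom-sets, the identity and associativity laws of \<open>C\<close> and the
  functor laws of \<open>G\<close> can be checked after applying \<open>F\<close>.
\<close>

lemma quasi_inverse_equivalencesI:
  fixes C :: "('o1, 'm1, 'e1) cat_scheme" and D :: "('o2, 'm2, 'e2) cat_scheme"
  assumes D: "category D"
    and IdnC: "\<And>x. x \<in> Obj C \<Longrightarrow> Idn C x \<in> Hom C x x"
    and CmpC: "\<And>x y z f g. \<lbrakk>x \<in> Obj C; y \<in> Obj C; z \<in> Obj C; f \<in> Hom C x y; g \<in> Hom C y z\<rbrakk>
      \<Longrightarrow> Cmp C x y z g f \<in> Hom C x z"
    and F_obj: "\<And>x. x \<in> Obj C \<Longrightarrow> ObjMap F x \<in> Obj D"
    and F_bij: "\<And>x y. \<lbrakk>x \<in> Obj C; y \<in> Obj C\<rbrakk>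
      \<Longrightarrow> bij_betw (MorMap F x y) (Hom C x y) (Hom D (ObjMap F x) (ObjMap F y))"
    and F_Idn: "\<And>x. x \<in> Obj C \<Longrightarrow> MorMap F x x (Idn C x) = Idn D (ObjMap F x)"
    and F_Cmp: "\<And>x y z f g. \<lbrakk>x \<in> Obj C; y \<in> Obj C; z \<in> Obj C; f \<in> Hom C x y; g \<in> Hom C y z\<rbrakk>
      \<Longrightarrow> MorMap F x z (Cmp C x y z g f) =
        Cmp D (ObjMap F x) (ObjMap F y) (ObjMap F z) (MorMap F y z g) (MorMap F x y f)"
    and G_obj: "\<And>x. x \<in> Obj D \<Longrightarrow> ObjMap G x \<in> Obj C"
    and G_Hom: "\<And>x y f. \<lbrakk>x \<in> Obj D; y \<in> Obj D; f \<in> Hom D x y\<rbrakk>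
      \<Longrightarrow> MorMap G x y f \<in> Hom C (ObjMap G x) (ObjMap G y)"
    and eps: "natural_iso D D (comp_functor F G) id_functor \<epsilon>"
  shows "quasi_inverse_equivalences C D F G"
proof -
  interpret D: category D by (fact D)
  have F_Hom: "MorMap F x y f \<in> Hom D (ObjMap F x) (ObjMap F y)"
    if "x \<in> Obj C" "y \<in> Obj C" "f \<in> Hom C x y" for x y f
    using bij_betwE[OF F_bij] that by blast
  have F_inj: "f = g" if "x \<in> Obj C" "y \<in> Obj C" "f \<in> Hom C x y" "g \<in> Hom C x y"
    "MorMap F x y f = MorMap F x y g" for x y f g
    using bij_betw_imp_inj_on[OF F_bij] that by (meson inj_onD)
  have F_surj: "\<exists>f \<in> Hom C x y. MorMap F x y f = g" if "x \<in> Obj C" "y \<in> Obj C"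
    "g \<in> Hom D (ObjMap F x) (ObjMap F y)" for x y g
    using bij_betw_imp_surj_on[OF F_bij[OF that(1,2)]] that(3) by (metis imageE)
  have C: "category C"
  proof
    fix x y f assume *: "x \<in> Obj C" "y \<in> Obj C" "f \<in> Hom C x y"
    show "Cmp C x y y (Idn C y) f = f" "Cmp C x x y f (Idn C x) = f"
      by (rule F_inj[of x y];
          simp add: * CmpC IdnC F_Cmp F_Idn F_obj F_Hom D.Cmp_Idn_left D.Cmp_Idn_right)+
  next
    fix w x y z f g h
    assume *: "w \<in> Obj C" "x \<in> Obj C" "y \<in> Obj C" "z \<in> Obj C"
      "f \<in> Hom C w x" "g \<in> Hom C x y" "h \<in> Hom C y z"
    have "Cmp C w y z h (Cmp C w x y g f) \<in> Hom C w z"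
      "Cmp C w x z (Cmp C x y z h g) f \<in> Hom C w z"
      using * by (meson CmpC)+
    moreover have "MorMap F w z (Cmp C w y z h (Cmp C w x y g f)) =
        MorMap F w z (Cmp C w x z (Cmp C x y z h g) f)"
      using * by (simp add: CmpC F_Cmp F_obj F_Hom D.Cmp_assoc)
    ultimately show "Cmp C w y z h (Cmp C w x y g f) = Cmp C w x z (Cmp C x y z h g) f"
      using F_inj[of w z] * by blast
  qed (use IdnC CmpC in auto)
  then interpret C: category C .
  have F: "is_functor C D F"
    unfolding is_functor_def using F_obj F_Hom F_Idn F_Cmp by blast

  define FG where "FG x = ObjMap F (ObjMap G x)" for x
  define FGm where "FGm x y f = MorMap F (ObjMap G x) (ObjMap G y) (MorMap G x y f)" for x y f
  have FG_obj: "FG x \<in> Obj D" if "x \<in> Obj D" for x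
    using that by (simp add: FG_def F_obj G_obj)
  have FGm_Hom: "FGm x y f \<in> Hom D (FG x) (FG y)"
    if "x \<in> Obj D" "y \<in> Obj D" "f \<in> Hom D x y" for x y f
    using that by (simp add: FG_def FGm_def F_Hom G_obj G_Hom)
  have iso: "\<forall>x \<in> Obj D. is_iso D (FG x) x (\<epsilon> x)"
    using eps by (auto simp: natural_iso_def comp_functor_def id_functor_def FG_def)
  then have eps_Hom: "\<epsilon> x \<in> Hom D (FG x) x" if "x \<in> Obj D" for x
    using that by (auto simp: is_iso_def)
  have eps_nat: "Cmp D (FG x) (FG y) y (\<epsilon> y) (FGm x y f) = Cmp D (FG x) x y f (\<epsilon> x)"
    if "x \<in> Obj D" "y \<in> Obj D" "f \<in> Hom D x y" for x y f
    using eps that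
    by (auto simp: natural_iso_def comp_functor_def id_functor_def FG_def FGm_def)
  from iso have "\<forall>x \<in> Obj D. \<exists>u. u \<in> Hom D x (FG x) \<and>
      Cmp D (FG x) x (FG x) u (\<epsilon> x) = Idn D (FG x) \<and> Cmp D x (FG x) x (\<epsilon> x) u = Idn D x"
    by (auto simp: is_iso_def)
  then obtain u where "\<forall>x \<in> Obj D. u x \<in> Hom D x (FG x) \<and>
      Cmp D (FG x) x (FG x) (u x) (\<epsilon> x) = Idn D (FG x) \<and> Cmp D x (FG x) x (\<epsilon> x) (u x) = Idn D x"
    by metis
  then have u_Hom: "u x \<in> Hom D x (FG x)"
    and u_eps: "Cmp D (FG x) x (FG x) (u x) (\<epsilon> x) = Idn D (FG x)"
    and eps_u: "Cmp D x (FG x) x (\<epsilon> x) (u x) = Idn D x" if "x \<in> Obj D" for x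
    using that by auto
  \<comment> \<open>On morphisms \<open>F G\<close> is conjugation by \<open>\<epsilon>\<close>, hence functorial; \<open>F\<close> being faithful, so is \<open>G\<close>.\<close>
  have FGm_eq: "FGm x y f = Cmp D (FG x) y (FG y) (u y) (Cmp D (FG x) x y f (\<epsilon> x))"
    if "x \<in> Obj D" "y \<in> Obj D" "f \<in> Hom D x y" for x y f
  proof -
    have "Cmp D (FG x) y (FG y) (u y) (Cmp D (FG x) (FG y) y (\<epsilon> y) (FGm x y f)) = FGm x y f"
      using that by (simp add: D.Cmp_assoc FG_obj FGm_Hom eps_Hom u_Hom u_eps D.Cmp_Idn_left)
    then show ?thesis by (simp add: eps_nat that)
  qed
  have u_nat: "Cmp D x (FG x) (FG y) (FGm x y f) (u x) = Cmp D x y (FG y) (u y) f"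
    if "x \<in> Obj D" "y \<in> Obj D" "f \<in> Hom D x y" for x y f
    using that
    by (simp add: FGm_eq D.Cmp_assoc[symmetric] FG_obj eps_Hom u_Hom D.Cmp_in_Hom eps_u
        D.Cmp_Idn_right)
  have FGm_Idn: "FGm x x (Idn D x) = Idn D (FG x)" if "x \<in> Obj D" for x
    using that by (simp add: FGm_eq D.Idn_in_Hom FG_obj eps_Hom u_eps D.Cmp_Idn_left)
  have FGm_Cmp: "FGm x z (Cmp D x y z g f) = Cmp D (FG x) (FG y) (FG z) (FGm y z g) (FGm x y f)"
    if "x \<in> Obj D" "y \<in> Obj D" "z \<in> Obj D" "f \<in> Hom D x y" "g \<in> Hom D y z" for x y z f g
  proof -
    have "Cmp D (FG x) (FG y) (FG z) (FGm y z g) (FGm x y f) =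
        Cmp D (FG x) y (FG z) (Cmp D y (FG y) (FG z) (FGm y z g) (u y)) (Cmp D (FG x) x y f (\<epsilon> x))"
      unfolding FGm_eq[OF that(1,2,4)]
      using that by (simp add: D.Cmp_assoc FG_obj FGm_Hom eps_Hom u_Hom D.Cmp_in_Hom)
    also have "\<dots> = FGm x z (Cmp D x y z g f)"
      unfolding u_nat[OF that(2,3,5)] FGm_eq[OF that(1,3) D.Cmp_in_Hom[OF that(1,2,3,4,5)]]
      using that by (simp add: D.Cmp_assoc FG_obj eps_Hom u_Hom D.Cmp_in_Hom)
    finally show ?thesis by simp
  qed
  have G: "is_functor D C G"
    unfolding is_functor_def
  proof (intro conjI ballI)
    fix x assume x: "x \<in> Obj D"
    show "MorMap G x x (Idn D x) = Idn C (ObjMap G x)"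
      by (rule F_inj[of "ObjMap G x" "ObjMap G x"])
        (use x FGm_Idn[OF x] in \<open>simp_all add: G_obj G_Hom D.Idn_in_Hom C.Idn_in_Hom FG_def FGm_def F_Idn\<close>)
  next
    fix x y z f g
    assume *: "x \<in> Obj D" "y \<in> Obj D" "z \<in> Obj D" "f \<in> Hom D x y" "g \<in> Hom D y z"
    show "MorMap G x z (Cmp D x y z g f) =
        Cmp C (ObjMap G x) (ObjMap G y) (ObjMap G z) (MorMap G y z g) (MorMap G x y f)"
      by (rule F_inj[of "ObjMap G x" "ObjMap G z"])
        (use * FGm_Cmp[OF *] in \<open>simp_all add: G_obj G_Hom D.Cmp_in_Hom C.Cmp_in_Hom FG_def FGm_def F_Cmp\<close>)
  qed (auto simp: G_obj G_Hom)

  \<comment> \<open>The unit at \<open>x\<close> is the preimage under \<open>F\<close> of the inverse of the counit at \<open>F x\<close>.\<close>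
  let ?GF = "\<lambda>x. ObjMap G (ObjMap F x)"
  have "\<forall>x \<in> Obj C. \<exists>e. e \<in> Hom C x (?GF x) \<and> MorMap F x (?GF x) e = u (ObjMap F x)"
  proof
    fix x assume x: "x \<in> Obj C"
    then have "u (ObjMap F x) \<in> Hom D (ObjMap F x) (ObjMap F (?GF x))"
      using u_Hom[OF F_obj[OF x]] by (simp add: FG_def)
    from F_surj[OF x _ this] show "\<exists>e. e \<in> Hom C x (?GF x) \<and> MorMap F x (?GF x) e = u (ObjMap F x)"
      using x by (auto simp: G_obj F_obj)
  qed
  then obtain \<eta> where eta_Hom: "\<And>x. x \<in> Obj C \<Longrightarrow> \<eta> x \<in> Hom C x (?GF x)"
    and F_eta: "\<And>x. x \<in> Obj C \<Longrightarrow> MorMap F x (?GF x) (\<eta> x) = u (ObjMap F x)"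
    by metis
  have "natural_iso C C id_functor (comp_functor G F) \<eta>"
    unfolding natural_iso_def comp_functor_def id_functor_def
  proof (simp, intro conjI ballI)
    fix x assume x: "x \<in> Obj C"
    then have GFx: "?GF x \<in> Obj C" and Fx: "ObjMap F x \<in> Obj D" by (simp_all add: F_obj G_obj)
    have "\<epsilon> (ObjMap F x) \<in> Hom D (ObjMap F (?GF x)) (ObjMap F x)"
      using eps_Hom[OF Fx] by (simp add: FG_def)
    then obtain v where v: "v \<in> Hom C (?GF x) x" "MorMap F (?GF x) x v = \<epsilon> (ObjMap F x)"
      using F_surj[OF GFx x] by blast
    have "Cmp C x (?GF x) x v (\<eta> x) = Idn C x"
      by (rule F_inj[of x x])
        (use x GFx v eps_u[OF Fx] in \<open>simp_all add: eta_Hom C.Cmp_in_Hom C.Idn_in_Hom F_Cmp F_Idn F_eta FG_def\<close>)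
    moreover have "Cmp C (?GF x) x (?GF x) (\<eta> x) v = Idn C (?GF x)"
      by (rule F_inj[of "?GF x" "?GF x"])
        (use x GFx v u_eps[OF Fx] in \<open>simp_all add: eta_Hom C.Cmp_in_Hom C.Idn_in_Hom F_Cmp F_Idn F_eta FG_def\<close>)
    ultimately show "is_iso C x (?GF x) (\<eta> x)"
      using v x eta_Hom by (auto simp: is_iso_def)
  next
    fix x y f assume *: "x \<in> Obj C" "y \<in> Obj C" "f \<in> Hom C x y"
    let ?GFf = "MorMap G (ObjMap F x) (ObjMap F y) (MorMap F x y f)"
    have GF: "?GF x \<in> Obj C" "?GF y \<in> Obj C" "?GFf \<in> Hom C (?GF x) (?GF y)"
      using * by (simp_all add: F_obj G_obj F_Hom G_Hom)
    show "Cmp C x y (?GF y) (\<eta> y) f = Cmp C x (?GF x) (?GF y) ?GFf (\<eta> x)"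
      by (rule F_inj[of x "?GF y"])
        (use * GF u_nat[OF F_obj[OF *(1)] F_obj[OF *(2)] F_Hom[OF *]] in
          \<open>simp_all add: eta_Hom C.Cmp_in_Hom F_Cmp F_eta FG_def FGm_def\<close>)
  qed
  then show ?thesis
    using C D F G eps by (auto simp: quasi_inverse_equivalences_def)
qed


section \<open>Finite sums of morphisms\<close>

lemma HomG_simps:
  "carrier (HomG A x y) = Hom A x y" "mult (HomG A x y) = hadd A x y"
  "one (HomG A x y) = hzero A x y"
  by (simp_all add: HomG_def)

context preadditive_category
begin

lemma hzero_in_Hom [simp]: "\<lbrakk>x \<in> Obj A; y \<in> Obj A\<rbrakk> \<Longrightarrow> hzero A x y \<in> Hom A x y"
proof -
  assume "x \<in> Obj A" "y \<in> Obj A"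
  then interpret comm_group "HomG A x y" by (rule HomG_comm_group)
  show ?thesis using one_closed by (simp add: HomG_simps)
qed

lemma Cmp_hzero_left:
  assumes "x \<in> Obj A" "y \<in> Obj A" "z \<in> Obj A" "f \<in> Hom A x y"
  shows "Cmp A x y z (hzero A y z) f = hzero A x z"
proof -
  interpret yz: comm_group "HomG A y z" using assms by (simp add: HomG_comm_group)
  interpret xz: comm_group "HomG A x z" using assms by (simp add: HomG_comm_group)
  let ?c = "Cmp A x y z (hzero A y z) f"
  have "hadd A y z (hzero A y z) (hzero A y z) = hzero A y z"
    using yz.l_one[OF yz.one_closed] by (simp add: HomG_simps)
  then have "hadd A x z ?c ?c = ?c"
    using Cmp_hadd_left[of x y z f "hzero A y z" "hzero A y z"] assms by simp
  moreover have "?c \<in> Hom A x z" using assms by (simp add: Cmp_in_Hom)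
  ultimately show ?thesis
    using xz.r_cancel_one[of ?c ?c] by (simp add: HomG_simps)
qed

lemma Cmp_hzero_right:
  assumes "x \<in> Obj A" "y \<in> Obj A" "z \<in> Obj A" "g \<in> Hom A y z"
  shows "Cmp A x y z g (hzero A x y) = hzero A x z"
proof -
  interpret xy: comm_group "HomG A x y" using assms by (simp add: HomG_comm_group)
  interpret xz: comm_group "HomG A x z" using assms by (simp add: HomG_comm_group)
  let ?c = "Cmp A x y z g (hzero A x y)"
  have "hadd A x y (hzero A x y) (hzero A x y) = hzero A x y"
    using xy.l_one[OF xy.one_closed] by (simp add: HomG_simps)
  then have "hadd A x z ?c ?c = ?c"
    using Cmp_hadd_right[of x y z "hzero A x y" "hzero A x y" g] assms by simp
  moreover have "?c \<in> Hom A x z" using assms by (simp add: Cmp_in_Hom)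
  ultimately show ?thesis
    using xz.r_cancel_one[of ?c ?c] by (simp add: HomG_simps)
qed

lemma is_zero_object_iff:
  assumes "z \<in> Obj A"
  shows "is_zero_object A z \<longleftrightarrow> Idn A z = hzero A z z"
proof
  assume "is_zero_object A z"
  then show "Idn A z = hzero A z z"
    using assms Idn_in_Hom hzero_in_Hom unfolding is_zero_object_def by blast
next
  assume *: "Idn A z = hzero A z z"
  have "f = hzero A z x" if "x \<in> Obj A" "f \<in> Hom A z x" for x f
    using Cmp_Idn_right[of z x f] Cmp_hzero_right[of z z x f] that assms * by simp
  moreover have "f = hzero A x z" if "x \<in> Obj A" "f \<in> Hom A x z" for x f
    using Cmp_Idn_left[of x z f] Cmp_hzero_left[of x z z f] that assms * by simp
  ultimately show "is_zero_object A z"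
    unfolding is_zero_object_def using assms hzero_in_Hom by blast
qed

lemma zero_object_target: "\<lbrakk>is_zero_object A z; x \<in> Obj A; f \<in> Hom A x z\<rbrakk> \<Longrightarrow> f = hzero A x z"
  unfolding is_zero_object_def using hzero_in_Hom by blast

lemma Cmp_zero_object:
  assumes "is_zero_object A z" "x \<in> Obj A" "y \<in> Obj A" "f \<in> Hom A x z" "g \<in> Hom A z y"
  shows "Cmp A x z y g f = hzero A x y"
proof -
  have "z \<in> Obj A" using assms(1) by (simp add: is_zero_object_def)
  then show ?thesis
    using zero_object_target[OF assms(1,2,4)] Cmp_hzero_right[of x z y g] assms by simp
qed

lemma hsum_in_Hom:
  assumes "x \<in> Obj A" "y \<in> Obj A" "\<And>j. j \<in> J \<Longrightarrow> f j \<in> Hom A x y"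
  shows "hsum A x y f J \<in> Hom A x y"
proof -
  interpret comm_group "HomG A x y" using assms by (simp add: HomG_comm_group)
  show ?thesis
    using finprod_closed[of f "{j \<in> J. f j \<noteq> hzero A x y}"] assms(3)
    by (auto simp: hsum_def HomG_simps)
qed

text \<open>Any finite index set that contains the support can be used to compute the sum.\<close>

lemma hsum_eq_finprod:
  assumes "x \<in> Obj A" "y \<in> Obj A" "finite K" "K \<subseteq> J" "\<And>j. j \<in> J \<Longrightarrow> f j \<in> Hom A x y"
    "\<And>j. j \<in> J - K \<Longrightarrow> f j = hzero A x y"
  shows "hsum A x y f J = finprod (HomG A x y) f K"
proof -
  interpret comm_group "HomG A x y" using assms by (simp add: HomG_comm_group)
  show ?thesis
    unfolding hsum_def
    by (rule finprod_mono_neutral_cong_left) (use assms in \<open>auto simp: HomG_simps\<close>)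
qed

lemma hsum_cong:
  assumes "x \<in> Obj A" "y \<in> Obj A" "\<And>j. j \<in> J \<Longrightarrow> f j = g j" "\<And>j. j \<in> J \<Longrightarrow> g j \<in> Hom A x y"
  shows "hsum A x y f J = hsum A x y g J"
proof -
  interpret comm_group "HomG A x y" using assms by (simp add: HomG_comm_group)
  show ?thesis
    unfolding hsum_def
    by (rule finprod_cong') (use assms in \<open>auto simp: HomG_simps\<close>)
qed

lemma hsum_single:
  assumes "x \<in> Obj A" "y \<in> Obj A" "i \<in> J" "f i \<in> Hom A x y"
    "\<And>j. \<lbrakk>j \<in> J; j \<noteq> i\<rbrakk> \<Longrightarrow> f j = hzero A x y"
  shows "hsum A x y f J = f i"
proof -
  interpret comm_group "HomG A x y" using assms by (simp add: HomG_comm_group)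
  have "f j \<in> Hom A x y" if "j \<in> J" for j
    using that assms by (cases "j = i") auto
  then have "hsum A x y f J = finprod (HomG A x y) f {i}"
    using assms by (intro hsum_eq_finprod) auto
  also have "\<dots> = f i" using assms(4) r_one[of "f i"] by (simp add: HomG_simps)
  finally show ?thesis .
qed

lemma hsum_zero:
  assumes "x \<in> Obj A" "y \<in> Obj A" "\<And>j. j \<in> J \<Longrightarrow> f j = hzero A x y"
  shows "hsum A x y f J = hzero A x y"
proof -
  interpret comm_group "HomG A x y" using assms by (simp add: HomG_comm_group)
  have "{j \<in> J. f j \<noteq> hzero A x y} = {}" using assms(3) by auto
  then show ?thesis by (simp only: hsum_def finprod_empty HomG_simps)
qed

lemma Cmp_finprod_right:
  assumes "x \<in> Obj A" "y \<in> Obj A" "z \<in> Obj A" "g \<in> Hom A y z"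
    "finite K" "\<And>j. j \<in> K \<Longrightarrow> f j \<in> Hom A x y"
  shows "Cmp A x y z g (finprod (HomG A x y) f K) =
    finprod (HomG A x z) (\<lambda>j. Cmp A x y z g (f j)) K"
proof -
  interpret xy: comm_group "HomG A x y" using assms by (simp add: HomG_comm_group)
  interpret xz: comm_group "HomG A x z" using assms by (simp add: HomG_comm_group)
  show ?thesis using assms(5,6)
  proof (induction K)
    case empty
    then show ?case using Cmp_hzero_right[OF assms(1-4)] by (simp add: HomG_simps)
  next
    case (insert k K)
    have "finprod (HomG A x y) f K \<in> carrier (HomG A x y)"
      using insert.prems by (intro xy.finprod_closed) (auto simp: HomG_simps)
    moreover have "(\<lambda>j. Cmp A x y z g (f j)) \<in> insert k K \<rightarrow> carrier (HomG A x z)"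
      using insert.prems assms(1-4) by (auto simp: HomG_simps Cmp_in_Hom)
    moreover have "f \<in> insert k K \<rightarrow> carrier (HomG A x y)"
      using insert.prems by (auto simp: HomG_simps)
    ultimately show ?case
      using insert assms(1-4) by (simp add: Pi_iff HomG_simps Cmp_hadd_right)
  qed
qed

lemma Cmp_finprod_left:
  assumes "x \<in> Obj A" "y \<in> Obj A" "z \<in> Obj A" "g \<in> Hom A x y"
    "finite K" "\<And>j. j \<in> K \<Longrightarrow> f j \<in> Hom A y z"
  shows "Cmp A x y z (finprod (HomG A y z) f K) g =
    finprod (HomG A x z) (\<lambda>j. Cmp A x y z (f j) g) K"
proof -
  interpret yz: comm_group "HomG A y z" using assms by (simp add: HomG_comm_group)
  interpret xz: comm_group "HomG A x z" using assms by (simp add: HomG_comm_group)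
  show ?thesis using assms(5,6)
  proof (induction K)
    case empty
    then show ?case using Cmp_hzero_left[OF assms(1-4)] by (simp add: HomG_simps)
  next
    case (insert k K)
    have "finprod (HomG A y z) f K \<in> carrier (HomG A y z)"
      using insert.prems by (intro yz.finprod_closed) (auto simp: HomG_simps)
    moreover have "(\<lambda>j. Cmp A x y z (f j) g) \<in> insert k K \<rightarrow> carrier (HomG A x z)"
      using insert.prems assms(1-4) by (auto simp: HomG_simps Cmp_in_Hom)
    moreover have "f \<in> insert k K \<rightarrow> carrier (HomG A y z)"
      using insert.prems by (auto simp: HomG_simps)
    ultimately show ?case
      using insert assms(1-4) by (simp add: Pi_iff HomG_simps Cmp_hadd_left)
  qed
qed

lemma Cmp_hsum_right:
  assumes "x \<in> Obj A" "y \<in> Obj A" "z \<in> Obj A" "g \<in> Hom A y z"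
    "finite {j \<in> J. f j \<noteq> hzero A x y}" "\<And>j. j \<in> J \<Longrightarrow> f j \<in> Hom A x y"
  shows "Cmp A x y z g (hsum A x y f J) = hsum A x z (\<lambda>j. Cmp A x y z g (f j)) J"
proof -
  have "hsum A x z (\<lambda>j. Cmp A x y z g (f j)) J =
      finprod (HomG A x z) (\<lambda>j. Cmp A x y z g (f j)) {j \<in> J. f j \<noteq> hzero A x y}"
    using assms by (intro hsum_eq_finprod) (auto simp: Cmp_in_Hom Cmp_hzero_right)
  then show ?thesis
    using Cmp_finprod_right[OF assms(1-5)] assms(6) by (simp add: hsum_def)
qed

lemma Cmp_hsum_left:
  assumes "x \<in> Obj A" "y \<in> Obj A" "z \<in> Obj A" "g \<in> Hom A x y"
    "finite {j \<in> J. f j \<noteq> hzero A y z}" "\<And>j. j \<in> J \<Longrightarrow> f j \<in> Hom A y z"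
  shows "Cmp A x y z (hsum A y z f J) g = hsum A x z (\<lambda>j. Cmp A x y z (f j) g) J"
proof -
  have "hsum A x z (\<lambda>j. Cmp A x y z (f j) g) J =
      finprod (HomG A x z) (\<lambda>j. Cmp A x y z (f j) g) {j \<in> J. f j \<noteq> hzero A y z}"
    using assms by (intro hsum_eq_finprod) (auto simp: Cmp_in_Hom Cmp_hzero_left)
  then show ?thesis
    using Cmp_finprod_left[OF assms(1-5)] assms(6) by (simp add: hsum_def)
qed

end


section \<open>Direct sums and matrices\<close>

text \<open>A family of objects only finitely many of which are non-zero.\<close>

definition finite_family :: "('o, 'm, 'e) precat_scheme \<Rightarrow> 'i set \<Rightarrow> ('i \<Rightarrow> 'o) \<Rightarrow> bool" where
  "finite_family A J X \<longleftrightarrow>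
     (\<forall>j \<in> J. X j \<in> Obj A) \<and> finite {j \<in> J. \<not> is_zero_object A (X j)}"

lemma finite_familyD: "\<lbrakk>finite_family A J X; j \<in> J\<rbrakk> \<Longrightarrow> X j \<in> Obj A"
  by (simp add: finite_family_def)

context additive_category
begin

lemma is_zero_object_zero_obj: "is_zero_object A (zero_obj A)"
  unfolding zero_obj_def using ex_zero_object by (rule someI_ex)

lemma zero_obj_in_Obj [simp]: "zero_obj A \<in> Obj A"
  using is_zero_object_zero_obj by (simp add: is_zero_object_def)

lemma ex_direct_sum:
  assumes "finite_family A J X"
  shows "\<exists>S \<iota> \<pi>. is_direct_sum A J X S \<iota> \<pi>"
proof -
  define K where "K = {j \<in> J. \<not> is_zero_object A (X j)}"
  have "finite K" "K \<subseteq> J" using assms by (auto simp: finite_family_def K_def)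
  \<comment> \<open>Induction on the set of indices where the object may be non-zero: the step replaces one object
    by zero and adds it back as a biproduct.\<close>
  have "\<exists>S \<iota> \<pi>. S \<in> Obj A \<and> (\<forall>j \<in> J. \<iota> j \<in> Hom A (X j) S \<and> \<pi> j \<in> Hom A S (X j)) \<and>
      (\<forall>i \<in> J. \<forall>j \<in> J. Cmp A (X j) S (X i) (\<pi> i) (\<iota> j) =
        (if i = j then Idn A (X j) else hzero A (X j) (X i))) \<and>
      finprod (HomG A S S) (\<lambda>j. Cmp A S (X j) S (\<iota> j) (\<pi> j)) K = Idn A S"
    if "\<forall>j \<in> J. X j \<in> Obj A" "\<forall>j \<in> J - K. is_zero_object A (X j)" for X
    using \<open>finite K\<close> \<open>K \<subseteq> J\<close> that
  proof (induction K arbitrary: X rule: finite_induct)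
    case empty
    let ?Z = "zero_obj A"
    interpret Z: comm_group "HomG A ?Z ?Z" by (simp add: HomG_comm_group)
    have Idn0: "Idn A (X j) = hzero A (X j) (X j)" if "j \<in> J" for j
      using that empty is_zero_object_iff by auto
    have "Idn A ?Z = hzero A ?Z ?Z"
      using is_zero_object_iff is_zero_object_zero_obj by simp
    then show ?case
      using empty Z.finprod_empty
      by (intro exI[of _ ?Z] exI[of _ "\<lambda>j. hzero A (X j) ?Z"] exI[of _ "\<lambda>j. hzero A ?Z (X j)"])
        (auto simp: HomG_simps Idn0 Cmp_hzero_left)
  next
    case (insert k K)
    define X' where "X' = X(k := zero_obj A)"
    have X'_eq: "X' j = X j" if "j \<noteq> k" for j using that by (simp add: X'_def)
    have X: "X j \<in> Obj A" if "j \<in> J" for j using that insert.prems by simp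
    have "\<forall>j \<in> J. X' j \<in> Obj A" "\<forall>j \<in> J - K. is_zero_object A (X' j)"
      using insert.prems is_zero_object_zero_obj by (auto simp: X'_def)
    from insert.IH[OF _ this] insert.prems(1) obtain S \<iota> \<pi> where S: "S \<in> Obj A"
      and hom': "\<forall>j \<in> J. \<iota> j \<in> Hom A (X' j) S \<and> \<pi> j \<in> Hom A S (X' j)"
      and orth': "\<forall>i \<in> J. \<forall>j \<in> J. Cmp A (X' j) S (X' i) (\<pi> i) (\<iota> j) =
        (if i = j then Idn A (X' j) else hzero A (X' j) (X' i))"
      and sum': "finprod (HomG A S S) (\<lambda>j. Cmp A S (X' j) S (\<iota> j) (\<pi> j)) K = Idn A S"
      by auto
    have hom: "\<iota> j \<in> Hom A (X j) S" "\<pi> j \<in> Hom A S (X j)" if "j \<in> J" "j \<noteq> k" for j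
      using hom' that X'_eq by metis+
    have orth: "Cmp A (X j) S (X i) (\<pi> i) (\<iota> j) =
        (if i = j then Idn A (X j) else hzero A (X j) (X i))"
      if "i \<in> J" "j \<in> J" "i \<noteq> k" "j \<noteq> k" for i j
      using orth' that X'_eq by metis
    have k: "k \<in> J" "X k \<in> Obj A" using insert by auto
    obtain T i1 i2 p1 p2 where T: "T \<in> Obj A" "i1 \<in> Hom A S T" "i2 \<in> Hom A (X k) T"
        "p1 \<in> Hom A T S" "p2 \<in> Hom A T (X k)"
      and bi: "Cmp A S T S p1 i1 = Idn A S" "Cmp A (X k) T (X k) p2 i2 = Idn A (X k)"
        "Cmp A (X k) T S p1 i2 = hzero A (X k) S" "Cmp A S T (X k) p2 i1 = hzero A S (X k)"
        "hadd A T T (Cmp A T S T i1 p1) (Cmp A T (X k) T i2 p2) = Idn A T"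
      using ex_biproduct[OF S k(2)] by blast
    interpret SS: comm_group "HomG A S S" using S by (simp add: HomG_comm_group)
    interpret TT: comm_group "HomG A T T" using T by (simp add: HomG_comm_group)
    let ?\<iota> = "\<lambda>j. if j = k then i2 else Cmp A (X j) S T i1 (\<iota> j)"
    let ?\<pi> = "\<lambda>j. if j = k then p2 else Cmp A T S (X j) (\<pi> j) p1"
    let ?e = "\<lambda>j. Cmp A T (X j) T (?\<iota> j) (?\<pi> j)"
    have hom1: "?\<iota> j \<in> Hom A (X j) T" "?\<pi> j \<in> Hom A T (X j)" if "j \<in> J" for j
      using that k S T X hom by (auto simp: Cmp_in_Hom)
    have e: "?e j \<in> Hom A T T" if "j \<in> J" for j
      using Cmp_in_Hom[OF T(1) X[OF that] T(1) hom1(2)[OF that] hom1(1)[OF that]] .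
    have "Cmp A (X j) T (X i) (?\<pi> i) (?\<iota> j) =
        (if i = j then Idn A (X j) else hzero A (X j) (X i))"
      if ij: "i \<in> J" "j \<in> J" for i j
    proof -
      have "Cmp A (X j) T (X i) (Cmp A T S (X i) (\<pi> i) p1) (Cmp A (X j) S T i1 (\<iota> j)) =
          Cmp A (X j) S (X i) (\<pi> i) (Cmp A (X j) S S (Cmp A S T S p1 i1) (\<iota> j))"
        if "i \<noteq> k" "j \<noteq> k"
        using that ij S T X hom by (simp add: Cmp_assoc Cmp_in_Hom)
      moreover have "Cmp A (X j) T (X k) p2 (Cmp A (X j) S T i1 (\<iota> j)) = hzero A (X j) (X k)"
        if "j \<noteq> k"
        using that ij k S T X hom bi by (simp add: Cmp_assoc Cmp_hzero_left)
      moreover have "Cmp A (X k) T (X i) (Cmp A T S (X i) (\<pi> i) p1) i2 = hzero A (X k) (X i)"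
        if "i \<noteq> k"
        using that ij k S T X hom bi by (simp add: Cmp_assoc[symmetric] Cmp_hzero_right)
      ultimately show ?thesis
        using ij k S T X hom bi orth[of i j] by (auto simp: Cmp_Idn_left)
    qed
    moreover have "finprod (HomG A T T) ?e (insert k K) = Idn A T"
    proof -
      have KJ: "j \<in> J" "j \<noteq> k" if "j \<in> K" for j using that insert by auto
      have c: "Cmp A S (X' j) S (\<iota> j) (\<pi> j) \<in> Hom A S S" if "j \<in> K" for j
        using KJ[OF that] S X hom by (simp add: X'_eq Cmp_in_Hom)
      have "finprod (HomG A T T) ?e K = finprod (HomG A T T)
          (\<lambda>j. Cmp A T S T i1 (Cmp A T S S (Cmp A S (X' j) S (\<iota> j) (\<pi> j)) p1)) K"
        by (rule TT.finprod_cong')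
          (use KJ S T X hom in \<open>auto simp: HomG_simps X'_eq Cmp_in_Hom Cmp_assoc\<close>)
      also have "\<dots> = Cmp A T S T i1 (Cmp A T S S (Idn A S) p1)"
        using S T c insert.hyps by (simp add: Cmp_finprod_right[symmetric]
            Cmp_finprod_left[symmetric] Cmp_in_Hom sum')
      also have "\<dots> = Cmp A T S T i1 p1"
        using S T by (simp add: Cmp_Idn_left)
      finally have sumK: "finprod (HomG A T T) ?e K = Cmp A T S T i1 p1" .
      have "finprod (HomG A T T) ?e (insert k K) = hadd A T T (?e k) (finprod (HomG A T T) ?e K)"
      proof -
        have "?e \<in> K \<rightarrow> carrier (HomG A T T)" "?e k \<in> carrier (HomG A T T)"
          using e KJ k(1) unfolding HomG_simps by blast+
        from TT.finprod_insert[OF insert.hyps this] show ?thesis unfolding HomG_simps .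
      qed
      also have "\<dots> = hadd A T T (Cmp A T S T i1 p1) (Cmp A T (X k) T i2 p2)"
        unfolding sumK
        using TT.m_comm[of "?e k" "Cmp A T S T i1 p1"] S T k e[of k] by (simp add: HomG_simps Cmp_in_Hom)
      finally show ?thesis using bi by simp
    qed
    ultimately show ?case
      using T(1) hom1 by (intro exI[of _ T] exI[of _ ?\<iota>] exI[of _ ?\<pi>]) blast
  qed
  from this[of X] obtain S \<iota> \<pi> where S: "S \<in> Obj A"
    and hom: "\<forall>j \<in> J. \<iota> j \<in> Hom A (X j) S \<and> \<pi> j \<in> Hom A S (X j)"
    and orth: "\<forall>i \<in> J. \<forall>j \<in> J. Cmp A (X j) S (X i) (\<pi> i) (\<iota> j) =
      (if i = j then Idn A (X j) else hzero A (X j) (X i))"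
    and sum: "finprod (HomG A S S) (\<lambda>j. Cmp A S (X j) S (\<iota> j) (\<pi> j)) K = Idn A S"
    using assms by (auto simp: finite_family_def K_def)
  have "hsum A S S (\<lambda>j. Cmp A S (X j) S (\<iota> j) (\<pi> j)) J =
      finprod (HomG A S S) (\<lambda>j. Cmp A S (X j) S (\<iota> j) (\<pi> j)) K"
    using S hom assms \<open>finite K\<close> \<open>K \<subseteq> J\<close>
    by (intro hsum_eq_finprod)
      (auto simp: finite_family_def Cmp_in_Hom K_def intro!: Cmp_zero_object)
  then have "is_direct_sum A J X S \<iota> \<pi>"
    using S hom orth sum assms by (simp add: is_direct_sum_def finite_family_def)
  then show ?thesis by blast
qed

lemma is_direct_sum_ds:
  assumes "finite_family A J X"
  shows "is_direct_sum A J X (ds_obj A J X) (ds_inj A J X) (ds_proj A J X)"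
proof -
  from ex_direct_sum[OF assms]
  have "\<exists>p. case p of (S, \<iota>, \<pi>) \<Rightarrow> is_direct_sum A J X S \<iota> \<pi>" by auto
  then have "case direct_sum A J X of (S, \<iota>, \<pi>) \<Rightarrow> is_direct_sum A J X S \<iota> \<pi>"
    unfolding direct_sum_def by (rule someI_ex)
  then show ?thesis
    by (simp add: ds_obj_def ds_inj_def ds_proj_def case_prod_beta)
qed

lemma ds_obj_in_Obj: "finite_family A J X \<Longrightarrow> ds_obj A J X \<in> Obj A"
  and ds_inj_in_Hom: "\<lbrakk>finite_family A J X; j \<in> J\<rbrakk> \<Longrightarrow> ds_inj A J X j \<in> Hom A (X j) (ds_obj A J X)"
  and ds_proj_in_Hom: "\<lbrakk>finite_family A J X; j \<in> J\<rbrakk> \<Longrightarrow> ds_proj A J X j \<in> Hom A (ds_obj A J X) (X j)"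
  and ds_proj_inj: "\<lbrakk>finite_family A J X; i \<in> J; j \<in> J\<rbrakk> \<Longrightarrow>
    Cmp A (X j) (ds_obj A J X) (X i) (ds_proj A J X i) (ds_inj A J X j) =
      (if i = j then Idn A (X j) else hzero A (X j) (X i))"
  and ds_sum_Idn: "finite_family A J X \<Longrightarrow>
    hsum A (ds_obj A J X) (ds_obj A J X)
      (\<lambda>j. Cmp A (ds_obj A J X) (X j) (ds_obj A J X) (ds_inj A J X j) (ds_proj A J X j)) J =
    Idn A (ds_obj A J X)"
  using is_direct_sum_ds[of J X] unfolding is_direct_sum_def by blast+

text \<open>A composite through a direct sum is the sum of the composites through the summands.\<close>

lemma Cmp_through_direct_sum:
  assumes X: "finite_family A J X" and x: "x \<in> Obj A" and y: "y \<in> Obj A"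
    and f: "f \<in> Hom A x (ds_obj A J X)" and g: "g \<in> Hom A (ds_obj A J X) y"
  shows "Cmp A x (ds_obj A J X) y g f =
    hsum A x y (\<lambda>j. Cmp A x (X j) y (Cmp A (X j) (ds_obj A J X) y g (ds_inj A J X j))
      (Cmp A x (ds_obj A J X) (X j) (ds_proj A J X j) f)) J"
proof -
  let ?S = "ds_obj A J X"
  let ?e = "\<lambda>j. Cmp A ?S (X j) ?S (ds_inj A J X j) (ds_proj A J X j)"
  note [simp] = finite_familyD[OF X] ds_obj_in_Obj[OF X] ds_inj_in_Hom[OF X] ds_proj_in_Hom[OF X]
  have fin: "finite {j \<in> J. \<not> is_zero_object A (X j)}" using X by (simp add: finite_family_def)
  have e: "?e j \<in> Hom A ?S ?S" if "j \<in> J" for j using that by (simp add: Cmp_in_Hom)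
  have fin1: "finite {j \<in> J. ?e j \<noteq> hzero A ?S ?S}"
    by (rule finite_subset[OF _ fin]) (auto simp: Cmp_zero_object)
  have fin2: "finite {j \<in> J. Cmp A x ?S ?S (?e j) f \<noteq> hzero A x ?S}"
    by (rule finite_subset[OF _ fin1]) (auto simp: x f Cmp_hzero_left)
  have "Cmp A x ?S y g f = Cmp A x ?S y g (Cmp A x ?S ?S (hsum A ?S ?S ?e J) f)"
    using x f by (simp add: ds_sum_Idn[OF X] Cmp_Idn_left)
  also have "\<dots> = hsum A x y (\<lambda>j. Cmp A x ?S y g (Cmp A x ?S ?S (?e j) f)) J"
    using x y f g e fin1 fin2 by (simp add: Cmp_hsum_left Cmp_hsum_right Cmp_in_Hom)
  also have "\<dots> = hsum A x y (\<lambda>j. Cmp A x (X j) y (Cmp A (X j) ?S y g (ds_inj A J X j))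
      (Cmp A x ?S (X j) (ds_proj A J X j) f)) J"
    by (rule hsum_cong) (use x y f g in \<open>simp_all add: Cmp_in_Hom Cmp_assoc\<close>)
  finally show ?thesis .
qed

lemma ds_eqI_proj:
  assumes X: "finite_family A J X" and x: "x \<in> Obj A"
    and f: "f \<in> Hom A x (ds_obj A J X)" "g \<in> Hom A x (ds_obj A J X)"
    and eq: "\<And>j. j \<in> J \<Longrightarrow> Cmp A x (ds_obj A J X) (X j) (ds_proj A J X j) f =
      Cmp A x (ds_obj A J X) (X j) (ds_proj A J X j) g"
  shows "f = g"
proof -
  note [simp] = finite_familyD[OF X] ds_obj_in_Obj[OF X] ds_inj_in_Hom[OF X] ds_proj_in_Hom[OF X]
  have "Cmp A x (ds_obj A J X) (ds_obj A J X) (Idn A (ds_obj A J X)) f =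
      Cmp A x (ds_obj A J X) (ds_obj A J X) (Idn A (ds_obj A J X)) g"
    unfolding Cmp_through_direct_sum[OF X x ds_obj_in_Obj[OF X] f(1) Idn_in_Hom[OF ds_obj_in_Obj[OF X]]]
      Cmp_through_direct_sum[OF X x ds_obj_in_Obj[OF X] f(2) Idn_in_Hom[OF ds_obj_in_Obj[OF X]]]
    by (rule hsum_cong) (use x f eq in \<open>simp_all add: Cmp_in_Hom Idn_in_Hom\<close>)
  then show ?thesis using x f by (simp add: Cmp_Idn_left)
qed

lemma ds_eqI_inj:
  assumes X: "finite_family A J X" and x: "x \<in> Obj A"
    and f: "f \<in> Hom A (ds_obj A J X) x" "g \<in> Hom A (ds_obj A J X) x"
    and eq: "\<And>j. j \<in> J \<Longrightarrow> Cmp A (X j) (ds_obj A J X) x f (ds_inj A J X j) =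
      Cmp A (X j) (ds_obj A J X) x g (ds_inj A J X j)"
  shows "f = g"
proof -
  note [simp] = finite_familyD[OF X] ds_obj_in_Obj[OF X] ds_inj_in_Hom[OF X] ds_proj_in_Hom[OF X]
  have "Cmp A (ds_obj A J X) (ds_obj A J X) x f (Idn A (ds_obj A J X)) =
      Cmp A (ds_obj A J X) (ds_obj A J X) x g (Idn A (ds_obj A J X))"
    unfolding Cmp_through_direct_sum[OF X ds_obj_in_Obj[OF X] x Idn_in_Hom[OF ds_obj_in_Obj[OF X]] f(1)]
      Cmp_through_direct_sum[OF X ds_obj_in_Obj[OF X] x Idn_in_Hom[OF ds_obj_in_Obj[OF X]] f(2)]
    by (rule hsum_cong) (use x f eq in \<open>simp_all add: Cmp_in_Hom Idn_in_Hom\<close>)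
  then show ?thesis using x f by (simp add: Cmp_Idn_right)
qed


lemma mat_mor_in_Hom:
  assumes "finite_family A J X" "finite_family A I Y"
    "\<And>i j. \<lbrakk>i \<in> I; j \<in> J\<rbrakk> \<Longrightarrow> \<alpha> i j \<in> Hom A (X j) (Y i)"
  shows "mat_mor A J X I Y \<alpha> \<in> Hom A (ds_obj A J X) (ds_obj A I Y)"
  unfolding mat_mor_def Let_def
  by (rule hsum_in_Hom)
    (use assms finite_familyD[OF assms(1)] finite_familyD[OF assms(2)] in
      \<open>auto simp: ds_obj_in_Obj ds_inj_in_Hom ds_proj_in_Hom Cmp_in_Hom\<close>)

text \<open>
  \<open>mat_mor_entry\<close> recovers a matrix from the morphism of direct sums that it defines, and
  \<open>mat_eqI\<close> says that a morphism of direct sums is determined by its components.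
\<close>

lemma mat_mor_entry:
  assumes X: "finite_family A J X" and Y: "finite_family A I Y"
    and \<alpha>: "\<And>i j. \<lbrakk>i \<in> I; j \<in> J\<rbrakk> \<Longrightarrow> \<alpha> i j \<in> Hom A (X j) (Y i)"
    and ij: "i \<in> I" "j \<in> J"
  shows "Cmp A (X j) (ds_obj A I Y) (Y i) (ds_proj A I Y i)
    (Cmp A (X j) (ds_obj A J X) (ds_obj A I Y) (mat_mor A J X I Y \<alpha>) (ds_inj A J X j)) = \<alpha> i j"
proof -
  let ?S = "ds_obj A J X" and ?T = "ds_obj A I Y"
  note [simp] = finite_familyD[OF X] ds_obj_in_Obj[OF X] ds_inj_in_Hom[OF X] ds_proj_in_Hom[OF X]
    finite_familyD[OF Y] ds_obj_in_Obj[OF Y] ds_inj_in_Hom[OF Y] ds_proj_in_Hom[OF Y] \<alpha> ij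
  define m where "m = (\<lambda>(p, q). Cmp A ?S (Y p) ?T (ds_inj A I Y p)
    (Cmp A ?S (X q) (Y p) (\<alpha> p q) (ds_proj A J X q)))"
  define m1 where "m1 p = Cmp A (X j) ?S ?T (m p) (ds_inj A J X j)" for p
  \<comment> \<open>\<open>m2 (p, q)\<close> contributes \<open>\<pi>\<^sub>i \<iota>\<^sub>p \<alpha>\<^sub>p\<^sub>q \<pi>\<^sub>q \<iota>\<^sub>j\<close>, which vanishes unless \<open>(p, q) = (i, j)\<close>.\<close>
  define m2 where "m2 p = Cmp A (X j) ?T (Y i) (ds_proj A I Y i) (m1 p)" for p
  have m: "m p \<in> Hom A ?S ?T" if "p \<in> I \<times> J" for p
    using that by (auto simp: m_def Cmp_in_Hom)
  have m1: "m1 p \<in> Hom A (X j) ?T" if "p \<in> I \<times> J" for p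
    using m[OF that] by (simp add: m1_def Cmp_in_Hom)
  have "finite ({i \<in> I. \<not> is_zero_object A (Y i)} \<times> {j \<in> J. \<not> is_zero_object A (X j)})"
    using X Y by (simp add: finite_family_def)
  then have fin: "finite {p \<in> I \<times> J. m p \<noteq> hzero A ?S ?T}"
    by (rule finite_subset[rotated])
      (auto simp: m_def Cmp_zero_object Cmp_in_Hom Cmp_hzero_right)
  then have fin1: "finite {p \<in> I \<times> J. m1 p \<noteq> hzero A (X j) ?T}"
    by (rule finite_subset[rotated]) (auto simp: m1_def Cmp_hzero_left)
  have m2: "m2 (p, q) = Cmp A (X j) (Y p) (Y i)
      (Cmp A (Y p) ?T (Y i) (ds_proj A I Y i) (ds_inj A I Y p))
      (Cmp A (X j) (X q) (Y p) (\<alpha> p q)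
        (Cmp A (X j) ?S (X q) (ds_proj A J X q) (ds_inj A J X j)))"
    if "p \<in> I" "q \<in> J" for p q
    using that by (simp add: m2_def m1_def m_def Cmp_assoc Cmp_in_Hom)
  have m2_ij: "m2 (i, j) = \<alpha> i j"
    using ds_proj_inj[OF X] ds_proj_inj[OF Y] by (simp add: m2 Cmp_Idn_left Cmp_Idn_right)
  have "mat_mor A J X I Y \<alpha> = hsum A ?S ?T m (I \<times> J)"
    by (simp add: mat_mor_def Let_def m_def)
  then have "Cmp A (X j) ?T (Y i) (ds_proj A I Y i)
      (Cmp A (X j) ?S ?T (mat_mor A J X I Y \<alpha>) (ds_inj A J X j)) = hsum A (X j) (Y i) m2 (I \<times> J)"
    using m m1 fin fin1 by (simp add: Cmp_hsum_left Cmp_hsum_right m2_def[abs_def] m1_def)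
  also have "\<dots> = m2 (i, j)"
  proof (rule hsum_single)
    fix p assume p: "p \<in> I \<times> J" "p \<noteq> (i, j)"
    then obtain i' j' where p': "p = (i', j')" "i' \<in> I" "j' \<in> J" "i' \<noteq> i \<or> j' \<noteq> j"
      by auto
    then show "m2 p = hzero A (X j) (Y i)"
      using ds_proj_inj[OF X] ds_proj_inj[OF Y]
      by (cases "i' = i") (simp_all add: m2 Cmp_hzero_left Cmp_hzero_right Cmp_in_Hom Idn_in_Hom)
  qed (simp_all add: m2_ij)
  finally show ?thesis by (simp add: m2_ij)
qed

lemma mat_eqI:
  assumes X: "finite_family A J X" and Y: "finite_family A I Y"
    and f: "f \<in> Hom A (ds_obj A J X) (ds_obj A I Y)" and g: "g \<in> Hom A (ds_obj A J X) (ds_obj A I Y)"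
    and eq: "\<And>i j. \<lbrakk>i \<in> I; j \<in> J\<rbrakk> \<Longrightarrow>
      Cmp A (X j) (ds_obj A I Y) (Y i) (ds_proj A I Y i)
        (Cmp A (X j) (ds_obj A J X) (ds_obj A I Y) f (ds_inj A J X j)) =
      Cmp A (X j) (ds_obj A I Y) (Y i) (ds_proj A I Y i)
        (Cmp A (X j) (ds_obj A J X) (ds_obj A I Y) g (ds_inj A J X j))"
  shows "f = g"
proof (rule ds_eqI_inj[OF X ds_obj_in_Obj[OF Y] f g], rule ds_eqI_proj[OF Y])
  note [simp] = finite_familyD[OF X] ds_obj_in_Obj[OF X] ds_inj_in_Hom[OF X] ds_obj_in_Obj[OF Y]
  fix j assume "j \<in> J"
  then show "X j \<in> Obj A"
    "Cmp A (X j) (ds_obj A J X) (ds_obj A I Y) f (ds_inj A J X j) \<in> Hom A (X j) (ds_obj A I Y)"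
    "Cmp A (X j) (ds_obj A J X) (ds_obj A I Y) g (ds_inj A J X j) \<in> Hom A (X j) (ds_obj A I Y)"
    using f g by (simp_all add: Cmp_in_Hom)
qed (rule eq)

lemma mat_mor_eqI:
  assumes X: "finite_family A J X" and Y: "finite_family A I Y"
    and \<alpha>: "\<And>i j. \<lbrakk>i \<in> I; j \<in> J\<rbrakk> \<Longrightarrow> \<alpha> i j \<in> Hom A (X j) (Y i)"
    and f: "f \<in> Hom A (ds_obj A J X) (ds_obj A I Y)"
    and eq: "\<And>i j. \<lbrakk>i \<in> I; j \<in> J\<rbrakk> \<Longrightarrow>
      Cmp A (X j) (ds_obj A I Y) (Y i) (ds_proj A I Y i)
        (Cmp A (X j) (ds_obj A J X) (ds_obj A I Y) f (ds_inj A J X j)) = \<alpha> i j"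
  shows "mat_mor A J X I Y \<alpha> = f"
  by (rule mat_eqI[OF X Y mat_mor_in_Hom[OF X Y \<alpha>] f])
    (simp_all add: \<alpha> eq mat_mor_entry[OF X Y \<alpha>])

lemma mat_mor_cong:
  assumes X: "finite_family A J X" and Y: "finite_family A I Y"
    and \<alpha>: "\<And>i j. \<lbrakk>i \<in> I; j \<in> J\<rbrakk> \<Longrightarrow> \<alpha> i j \<in> Hom A (X j) (Y i)"
    and eq: "\<And>i j. \<lbrakk>i \<in> I; j \<in> J\<rbrakk> \<Longrightarrow> \<beta> i j = \<alpha> i j"
  shows "mat_mor A J X I Y \<beta> = mat_mor A J X I Y \<alpha>"
  by (rule mat_mor_eqI[OF X Y _ mat_mor_in_Hom[OF X Y \<alpha>]])
    (simp_all add: \<alpha> eq mat_mor_entry[OF X Y \<alpha>])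

text \<open>
  A product of matrices consists of the entries of the composite morphism of direct sums; so
  identities between matrix products are inherited from composition.
\<close>

lemma mat_mult_eq_entry:
  assumes X: "finite_family A J X" and Y: "finite_family A K Y" and Z: "finite_family A I Z"
    and \<alpha>: "\<And>c j. \<lbrakk>c \<in> K; j \<in> J\<rbrakk> \<Longrightarrow> \<alpha> c j \<in> Hom A (X j) (Y c)"
    and \<beta>: "\<And>i c. \<lbrakk>i \<in> I; c \<in> K\<rbrakk> \<Longrightarrow> \<beta> i c \<in> Hom A (Y c) (Z i)"
    and ij: "i \<in> I" "j \<in> J"
  shows "mat_mult A K X Y Z \<beta> \<alpha> i j =
    Cmp A (X j) (ds_obj A I Z) (Z i) (ds_proj A I Z i)
      (Cmp A (X j) (ds_obj A J X) (ds_obj A I Z)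
        (Cmp A (ds_obj A J X) (ds_obj A K Y) (ds_obj A I Z) (mat_mor A K Y I Z \<beta>) (mat_mor A J X K Y \<alpha>))
        (ds_inj A J X j))"
proof -
  let ?S = "ds_obj A J X" and ?T = "ds_obj A K Y" and ?U = "ds_obj A I Z"
  note [simp] = finite_familyD[OF X] ds_obj_in_Obj[OF X] ds_inj_in_Hom[OF X] ds_proj_in_Hom[OF X]
    finite_familyD[OF Y] ds_obj_in_Obj[OF Y] ds_inj_in_Hom[OF Y] ds_proj_in_Hom[OF Y]
    finite_familyD[OF Z] ds_obj_in_Obj[OF Z] ds_inj_in_Hom[OF Z] ds_proj_in_Hom[OF Z] \<alpha> \<beta> ij
    mat_mor_in_Hom[OF X Y \<alpha>] mat_mor_in_Hom[OF Y Z \<beta>] Cmp_in_Hom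
  let ?f = "Cmp A (X j) ?S ?T (mat_mor A J X K Y \<alpha>) (ds_inj A J X j)"
  let ?g = "Cmp A ?T ?U (Z i) (ds_proj A I Z i) (mat_mor A K Y I Z \<beta>)"
  have "Cmp A (X j) ?T (Z i) ?g ?f = hsum A (X j) (Z i)
      (\<lambda>c. Cmp A (X j) (Y c) (Z i) (Cmp A (Y c) ?T (Z i) ?g (ds_inj A K Y c))
        (Cmp A (X j) ?T (Y c) (ds_proj A K Y c) ?f)) K"
    by (rule Cmp_through_direct_sum[OF Y]) simp_all
  also have "\<dots> = mat_mult A K X Y Z \<beta> \<alpha> i j"
    unfolding mat_mult_def
  proof (rule hsum_cong)
    fix c assume "c \<in> K"
    then show "Cmp A (X j) (Y c) (Z i) (Cmp A (Y c) ?T (Z i) ?g (ds_inj A K Y c))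
        (Cmp A (X j) ?T (Y c) (ds_proj A K Y c) ?f) = Cmp A (X j) (Y c) (Z i) (\<beta> i c) (\<alpha> c j)"
      using mat_mor_entry[OF X Y \<alpha>] mat_mor_entry[OF Y Z \<beta>] by (simp add: Cmp_assoc[symmetric])
  qed simp_all
  finally show ?thesis by (simp add: Cmp_assoc)
qed

lemma mat_mult_in_Hom:
  assumes "finite_family A J X" "finite_family A K Y" "finite_family A I Z"
    "\<And>c j. \<lbrakk>c \<in> K; j \<in> J\<rbrakk> \<Longrightarrow> \<alpha> c j \<in> Hom A (X j) (Y c)"
    "\<And>i c. \<lbrakk>i \<in> I; c \<in> K\<rbrakk> \<Longrightarrow> \<beta> i c \<in> Hom A (Y c) (Z i)"
    "i \<in> I" "j \<in> J"
  shows "mat_mult A K X Y Z \<beta> \<alpha> i j \<in> Hom A (X j) (Z i)"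
  unfolding mat_mult_def
  by (rule hsum_in_Hom)
    (use assms in \<open>auto simp: Cmp_in_Hom finite_familyD\<close>)

lemma mat_mor_mult:
  assumes X: "finite_family A J X" and Y: "finite_family A K Y" and Z: "finite_family A I Z"
    and \<alpha>: "\<And>c j. \<lbrakk>c \<in> K; j \<in> J\<rbrakk> \<Longrightarrow> \<alpha> c j \<in> Hom A (X j) (Y c)"
    and \<beta>: "\<And>i c. \<lbrakk>i \<in> I; c \<in> K\<rbrakk> \<Longrightarrow> \<beta> i c \<in> Hom A (Y c) (Z i)"
  shows "mat_mor A J X I Z (mat_mult A K X Y Z \<beta> \<alpha>) =
    Cmp A (ds_obj A J X) (ds_obj A K Y) (ds_obj A I Z) (mat_mor A K Y I Z \<beta>) (mat_mor A J X K Y \<alpha>)"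
proof (rule mat_mor_eqI[OF X Z])
  show "Cmp A (ds_obj A J X) (ds_obj A K Y) (ds_obj A I Z) (mat_mor A K Y I Z \<beta>) (mat_mor A J X K Y \<alpha>)
      \<in> Hom A (ds_obj A J X) (ds_obj A I Z)"
    using X Y Z mat_mor_in_Hom[OF X Y \<alpha>] mat_mor_in_Hom[OF Y Z \<beta>]
    by (simp add: Cmp_in_Hom ds_obj_in_Obj)
qed (rule mat_mult_in_Hom[OF X Y Z \<alpha> \<beta>] mat_mult_eq_entry[OF X Y Z \<alpha> \<beta>, symmetric]; assumption)+

lemma mat_mor_Idn:
  assumes X: "finite_family A J X"
  shows "mat_mor A J X J X (\<lambda>i j. if i = j then Idn A (X i) else hzero A (X j) (X i)) =
    Idn A (ds_obj A J X)"
  by (rule mat_mor_eqI[OF X X])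
    (use finite_familyD[OF X] in
      \<open>auto simp: Idn_in_Hom ds_obj_in_Obj[OF X] ds_inj_in_Hom[OF X] ds_proj_inj[OF X] Cmp_Idn_left\<close>)

lemma mat_mor_single:
  assumes X: "finite_family A J X" and Y: "finite_family A I Y" and ab: "a \<in> I" "b \<in> J"
    and f: "f \<in> Hom A (X b) (Y a)"
  shows "mat_mor A J X I Y (\<lambda>i j. if i = a \<and> j = b then f else hzero A (X j) (Y i)) =
    Cmp A (ds_obj A J X) (Y a) (ds_obj A I Y) (ds_inj A I Y a)
      (Cmp A (ds_obj A J X) (X b) (Y a) f (ds_proj A J X b))"
proof (rule mat_mor_eqI[OF X Y])
  let ?S = "ds_obj A J X" and ?T = "ds_obj A I Y"
  note [simp] = finite_familyD[OF X] ds_obj_in_Obj[OF X] ds_inj_in_Hom[OF X] ds_proj_in_Hom[OF X]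
    finite_familyD[OF Y] ds_obj_in_Obj[OF Y] ds_inj_in_Hom[OF Y] ds_proj_in_Hom[OF Y] ab f Cmp_in_Hom
  fix i j assume ij [simp]: "i \<in> I" "j \<in> J"
  show "(if i = a \<and> j = b then f else hzero A (X j) (Y i)) \<in> Hom A (X j) (Y i)"
    by auto
  have "Cmp A (X j) ?T (Y i) (ds_proj A I Y i)
      (Cmp A (X j) ?S ?T (Cmp A ?S (Y a) ?T (ds_inj A I Y a) (Cmp A ?S (X b) (Y a) f (ds_proj A J X b)))
        (ds_inj A J X j)) =
    Cmp A (X j) (Y a) (Y i) (Cmp A (Y a) ?T (Y i) (ds_proj A I Y i) (ds_inj A I Y a))
      (Cmp A (X j) (X b) (Y a) f (Cmp A (X j) ?S (X b) (ds_proj A J X b) (ds_inj A J X j)))"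
    by (simp add: Cmp_assoc)
  then show "Cmp A (X j) ?T (Y i) (ds_proj A I Y i)
      (Cmp A (X j) ?S ?T (Cmp A ?S (Y a) ?T (ds_inj A I Y a) (Cmp A ?S (X b) (Y a) f (ds_proj A J X b)))
        (ds_inj A J X j)) = (if i = a \<and> j = b then f else hzero A (X j) (Y i))"
    by (auto simp: ds_proj_inj[OF X] ds_proj_inj[OF Y] Cmp_Idn_left Cmp_Idn_right
        Cmp_hzero_left Cmp_hzero_right Idn_in_Hom)
qed (simp add: Cmp_in_Hom finite_familyD[OF X] finite_familyD[OF Y] ds_obj_in_Obj[OF X]
    ds_obj_in_Obj[OF Y] ds_inj_in_Hom[OF Y] ds_proj_in_Hom[OF X] ab f)

end


section \<open>Index vectors\<close>

lemma ht_eq_sum: "\<lbrakk>finite K; Poly_Mapping.keys a \<subseteq> K\<rbrakk> \<Longrightarrow> ht a = (\<Sum>i \<in> K. Poly_Mapping.lookup a i)"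
  unfolding ht_def by (rule sum.mono_neutral_left) (auto simp: in_keys_iff)

lemma ht_add [simp]: "ht (a + b) = ht a + ht b"
proof -
  let ?K = "Poly_Mapping.keys a \<union> Poly_Mapping.keys b"
  have "Poly_Mapping.keys (a + b) \<subseteq> ?K" by (rule Poly_Mapping.keys_add)
  then show ?thesis
    by (simp add: ht_eq_sum[of ?K] lookup_add sum.distrib)
qed

lemma ht_eps [simp]: "ht (eps i) = 1"
  by (simp add: ht_def eps_def)

lemma ht_axis [simp]: "ht (axis k) = k"
  by (cases "k = 0") (simp_all add: ht_def axis_def)

lemma axis_add_eps [simp]: "axis k + eps 0 = axis (k + 1)"
  by (simp add: axis_def eps_def single_add)

lemma axis_in_Idx [simp]: "axis k \<in> Idx k"
  by (simp add: Idx_def)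

lemma eps_inject [simp]: "eps i = eps j \<longleftrightarrow> i = j"
proof
  assume "eps i = eps j"
  then have "Poly_Mapping.lookup (eps i) i = Poly_Mapping.lookup (eps j) i" by simp
  then show "i = j" by (simp add: eps_def lookup_single when_def split: if_splits)
qed simp

lemma eps_add_eps_eq:
  assumes "eps p + eps q = eps i + eps j"
  shows "p = i \<and> q = j \<or> p = j \<and> q = i"
proof -
  have "(1 when l = p) + (1 when l = q) = (1 when l = i) + ((1::int) when l = j)" for l
    using arg_cong[OF assms, of "\<lambda>a. Poly_Mapping.lookup a l"]
    by (simp add: eps_def lookup_add lookup_single when_def)
  from this[of p] this[of q] show ?thesis
    by (auto simp: when_def split: if_splits)
qed

text \<open>
  Of \<open>n\<close> coordinates with given sum, each is bounded from below once all are bounded from above.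
\<close>

lemma finite_bounded_Idx:
  assumes "m \<ge> 0"
  shows "finite {a \<in> Idx k. (\<forall>i \<ge> n. Poly_Mapping.lookup a i = 0) \<and> (\<forall>i. Poly_Mapping.lookup a i \<le> m)}"
    (is "finite ?B")
proof -
  let ?F = "{f. \<forall>i. (i \<in> {..<n} \<longrightarrow> f i \<in> {k - int n * m..m}) \<and> (i \<notin> {..<n} \<longrightarrow> f i = 0)}"
  have "Poly_Mapping.lookup ` ?B \<subseteq> ?F"
  proof clarify
    fix a i assume a: "a \<in> Idx k" "\<forall>i \<ge> n. Poly_Mapping.lookup a i = 0" "\<forall>i. Poly_Mapping.lookup a i \<le> m"
    have "Poly_Mapping.lookup a i \<ge> k - int n * m" if "i < n"
    proof -
      have "Poly_Mapping.keys a \<subseteq> {..<n}" using a(2) by (auto simp: in_keys_iff not_le[symmetric])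
      then have "k = (\<Sum>j<n. Poly_Mapping.lookup a j)"
        using a(1) ht_eq_sum[of "{..<n}" a] by (simp add: Idx_def)
      also have "\<dots> = Poly_Mapping.lookup a i + (\<Sum>j \<in> {..<n} - {i}. Poly_Mapping.lookup a j)"
        using that by (simp add: sum.remove)
      also have "(\<Sum>j \<in> {..<n} - {i}. Poly_Mapping.lookup a j) \<le> (\<Sum>j \<in> {..<n} - {i}. m)"
        using a(3) by (intro sum_mono) auto
      also have "(\<Sum>j \<in> {..<n} - {i}. m) \<le> (\<Sum>j<n. m)"
        using assms by (intro sum_mono2) auto
      finally show ?thesis by simp
    qed
    then show "(i \<in> {..<n} \<longrightarrow> Poly_Mapping.lookup a i \<in> {k - int n * m..m}) \<and>
        (i \<notin> {..<n} \<longrightarrow> Poly_Mapping.lookup a i = 0)"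
      using a by auto
  qed
  moreover have "finite ?F" by (rule finite_set_of_finite_funs) auto
  ultimately have "finite (Poly_Mapping.lookup ` ?B)" by (rule finite_subset)
  then show ?thesis
    by (rule finite_imageD) (auto intro!: inj_onI poly_mapping_eqI)
qed


section \<open>The total complex of a pyramid\<close>

context additive_category
begin

lemma
  assumes "is_pyramid A P"
  shows pobj_in_Obj: "pobj P a \<in> Obj A"
    and pdiff_in_Hom: "pdiff P a i \<in> Hom A (pobj P a) (pobj P (a + eps i))"
    and pdiff_square: "Cmp A (pobj P a) (pobj P (a + eps i)) (pobj P (a + eps i + eps i))
      (pdiff P (a + eps i) i) (pdiff P a i) = hzero A (pobj P a) (pobj P (a + eps i + eps i))"
    and pdiff_anticommute: "Cmp A (pobj P a) (pobj P (a + eps i)) (pobj P (a + eps i + eps j))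
      (pdiff P (a + eps i) j) (pdiff P a i) = inv\<^bsub>HomG A (pobj P a) (pobj P (a + eps i + eps j))\<^esub>
        (Cmp A (pobj P a) (pobj P (a + eps j)) (pobj P (a + eps j + eps i))
          (pdiff P (a + eps j) i) (pdiff P a j))"
  using assms unfolding is_pyramid_def Let_def by blast+

text \<open>
  The bound on the coordinates may be taken to be non-negative, as \<open>finite_bounded_Idx\<close> requires.
\<close>

lemma pyramid_support:
  assumes "is_pyramid A P"
  obtains m n where "m \<ge> 0" "\<And>a. \<not> is_zero_object A (pobj P a) \<Longrightarrow>
    (\<forall>i \<ge> n. Poly_Mapping.lookup a i = 0) \<and> (\<forall>i. Poly_Mapping.lookup a i \<le> m)"
proof -
  obtain m where "\<forall>a. \<not> (\<forall>i. Poly_Mapping.lookup a i < m) \<longrightarrow> is_zero_object A (pobj P a)"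
    using assms unfolding is_pyramid_def Let_def by blast
  then have "\<forall>i. Poly_Mapping.lookup a i < m" if "\<not> is_zero_object A (pobj P a)" for a
    using that by blast
  then have "\<forall>i. Poly_Mapping.lookup a i \<le> max m 0" if "\<not> is_zero_object A (pobj P a)" for a
    using that by (simp add: le_max_iff_disj less_imp_le)
  moreover have "\<forall>i \<ge> pdim P. Poly_Mapping.lookup a i = 0" if "\<not> is_zero_object A (pobj P a)" for a
    using assms that unfolding is_pyramid_def Let_def by blast
  ultimately show thesis using that[of "max m 0" "pdim P"] by simp
qed

lemma finite_family_pobj:
  assumes "is_pyramid A P"
  shows "finite_family A (Idx k) (pobj P)"
proof -
  obtain m n where mn: "m \<ge> 0" "\<And>a. \<not> is_zero_object A (pobj P a) \<Longrightarrow>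
      (\<forall>i \<ge> n. Poly_Mapping.lookup a i = 0) \<and> (\<forall>i. Poly_Mapping.lookup a i \<le> m)"
    using pyramid_support[OF assms] by blast
  have "finite {a \<in> Idx k. \<not> is_zero_object A (pobj P a)}"
    by (rule finite_subset[OF _ finite_bounded_Idx[OF mn(1)]]) (use mn(2) in blast)
  then show ?thesis by (simp add: finite_family_def pobj_in_Obj[OF assms])
qed

lemma pyramid_zero_above:
  assumes "is_pyramid A P"
  shows "\<exists>K. \<forall>k \<ge> K. \<forall>a \<in> Idx k. is_zero_object A (pobj P a)"
proof -
  obtain m n where mn: "m \<ge> 0" "\<And>a. \<not> is_zero_object A (pobj P a) \<Longrightarrow>
      (\<forall>i \<ge> n. Poly_Mapping.lookup a i = 0) \<and> (\<forall>i. Poly_Mapping.lookup a i \<le> m)"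
    using pyramid_support[OF assms] by blast
  have "ht a \<le> int n * m" if a: "\<not> is_zero_object A (pobj P a)" for a
  proof -
    have "Poly_Mapping.keys a \<subseteq> {..<n}"
      using mn(2)[OF a] by (auto simp: in_keys_iff not_le[symmetric])
    then have "ht a = (\<Sum>i<n. Poly_Mapping.lookup a i)" by (simp add: ht_eq_sum)
    also have "\<dots> \<le> (\<Sum>i<n. m)" using mn(2)[OF a] by (intro sum_mono) auto
    finally show ?thesis by simp
  qed
  then have "\<forall>k \<ge> int n * m + 1. \<forall>a \<in> Idx k. is_zero_object A (pobj P a)"
    by (fastforce simp: Idx_def)
  then show ?thesis by blast
qed

lemma pmat_eps [simp]: "pmat A P (b + eps i) b = pdiff P b i"
  by (simp add: pmat_def)

lemma pmat_eq_hzero: "(\<And>i. a \<noteq> b + eps i) \<Longrightarrow> pmat A P a b = hzero A (pobj P b) (pobj P a)"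
  by (simp add: pmat_def)

lemma pmat_in_Hom: "is_pyramid A P \<Longrightarrow> pmat A P a b \<in> Hom A (pobj P b) (pobj P a)"
  by (cases "\<exists>i. a = b + eps i") (auto simp: pmat_eq_hzero pdiff_in_Hom pobj_in_Obj)

text \<open>
  In the square of the matrix of differentials, the entry from \<open>b\<close> to \<open>b + \<epsilon>\<^sub>i + \<epsilon>\<^sub>j\<close> has only the
  summands through \<open>b + \<epsilon>\<^sub>i\<close> and \<open>b + \<epsilon>\<^sub>j\<close>, which cancel if \<open>i \<noteq> j\<close>; if \<open>i = j\<close>, the only summand
  is the square of a differential and vanishes.
\<close>

lemma pmat_square:
  assumes P: "is_pyramid A P" and b: "b \<in> Idx k"
  shows "mat_mult A (Idx (k + 1)) (pobj P) (pobj P) (pobj P) (pmat A P) (pmat A P) a b =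
    hzero A (pobj P b) (pobj P a)"
proof -
  let ?X = "pobj P"
  let ?e = "\<lambda>c. Cmp A (?X b) (?X c) (?X a) (pmat A P a c) (pmat A P c b)"
  note [simp] = pobj_in_Obj[OF P] pmat_in_Hom[OF P]
  interpret comm_group "HomG A (?X b) (?X a)" by (simp add: HomG_comm_group)
  have e: "?e c \<in> Hom A (?X b) (?X a)" for c by (simp add: Cmp_in_Hom)
  have e0: "?e c = hzero A (?X b) (?X a)" if "\<not> (\<exists>p q. c = b + eps p \<and> a = c + eps q)" for c
  proof (cases "\<exists>p. c = b + eps p")
    case True
    then have "pmat A P a c = hzero A (?X c) (?X a)" using that by (intro pmat_eq_hzero) blast
    then show ?thesis by (simp add: Cmp_hzero_left)
  next
    case False
    then have "pmat A P c b = hzero A (?X b) (?X c)" by (intro pmat_eq_hzero) blast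
    then show ?thesis by (simp add: Cmp_hzero_right)
  qed
  have "hsum A (?X b) (?X a) ?e (Idx (k + 1)) = hzero A (?X b) (?X a)"
  proof (cases "\<exists>i j. a = b + eps i + eps j")
    case False
    then show ?thesis by (intro hsum_zero e0) auto
  next
    case True
    then obtain i j where a: "a = b + eps i + eps j" by blast
    then have a': "a = b + eps j + eps i" by (simp add: ac_simps)
    have path: "c = b + eps i \<or> c = b + eps j" if c: "c = b + eps p" "a = c + eps q" for c p q
    proof -
      have "eps p + eps q = eps i + eps j" using c a by (simp add: add.assoc)
      then show ?thesis using eps_add_eps_eq c(1) by blast
    qed
    have "hsum A (?X b) (?X a) ?e (Idx (k + 1)) =
        finprod (HomG A (?X b) (?X a)) ?e {b + eps i, b + eps j}"
      using b path by (intro hsum_eq_finprod e e0) (auto simp: Idx_def)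
    also have "\<dots> = hzero A (?X b) (?X a)"
    proof (cases "i = j")
      case True
      have "?e (b + eps i) = hzero A (?X b) (?X a)"
        using pdiff_square[OF P, of b i] by (simp only: pmat_eps a True)
      then show ?thesis using True r_one[OF one_closed] by (simp add: HomG_simps)
    next
      case False
      have "?e (b + eps i) = Cmp A (?X b) (?X (b + eps i)) (?X a) (pdiff P (b + eps i) j) (pdiff P b i)"
        by (simp add: a)
      also have "\<dots> = inv\<^bsub>HomG A (?X b) (?X a)\<^esub>
          (Cmp A (?X b) (?X (b + eps j)) (?X a) (pdiff P (b + eps j) i) (pdiff P b j))"
        using pdiff_anticommute[OF P, of b i j] unfolding a[symmetric] a'[symmetric] .
      also have "Cmp A (?X b) (?X (b + eps j)) (?X a) (pdiff P (b + eps j) i) (pdiff P b j) =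
          ?e (b + eps j)"
        by (simp add: a')
      finally have inv: "?e (b + eps i) = inv\<^bsub>HomG A (?X b) (?X a)\<^esub> ?e (b + eps j)" .
      have ec: "?e c \<in> carrier (HomG A (?X b) (?X a))" for c using e by (simp add: HomG_simps)
      have "finprod (HomG A (?X b) (?X a)) ?e {b + eps i, b + eps j} =
          ?e (b + eps i) \<otimes>\<^bsub>HomG A (?X b) (?X a)\<^esub> finprod (HomG A (?X b) (?X a)) ?e {b + eps j}"
        using False ec by (intro finprod_insert) (auto simp del: pmat_eps)
      also have "finprod (HomG A (?X b) (?X a)) ?e {b + eps j} = ?e (b + eps j)"
        using finprod_insert[OF finite.emptyI, of "b + eps j" ?e] ec r_one[OF ec]
        by (simp del: pmat_eps)
      finally show ?thesis unfolding inv using l_inv[OF ec] by (simp only: HomG_simps)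
    qed
    finally show ?thesis .
  qed
  then show ?thesis by (simp add: mat_mult_def)
qed

end

section \<open>The total complex functor is fully faithful\<close>

lemma in_Obj_Com_minus: "M \<in> Obj (Com_minus A) \<longleftrightarrow>
    is_complex A M \<and> (\<exists>K. \<forall>k \<ge> K. is_zero_object A (cobj M k))"
  and in_Hom_Com_minus: "g \<in> Hom (Com_minus A) M N \<longleftrightarrow>
    (\<forall>k. g k \<in> Hom A (cobj M k) (cobj N k)) \<and>
    (\<forall>k. Cmp A (cobj M k) (cobj M (k + 1)) (cobj N (k + 1)) (g (k + 1)) (cdiff M k) =
         Cmp A (cobj M k) (cobj N k) (cobj N (k + 1)) (cdiff N k) (g k))"
  and Cmp_Com_minus: "Cmp (Com_minus A) M N L h g =
    (\<lambda>k. Cmp A (cobj M k) (cobj N k) (cobj L k) (h k) (g k))"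
  and Idn_Com_minus: "Idn (Com_minus A) M = (\<lambda>k. Idn A (cobj M k))"
  by (simp_all add: Com_minus_def)

lemma FTot_simps:
  "cobj (ObjMap (FTot A) P) k = ds_obj A (Idx k) (pobj P)"
  "cdiff (ObjMap (FTot A) P) k = mat_mor A (Idx k) (pobj P) (Idx (k + 1)) (pobj P) (pmat A P)"
  "MorMap (FTot A) P Q \<alpha> = (\<lambda>k. mat_mor A (Idx k) (pobj P) (Idx k) (pobj Q) (\<alpha> k))"
  by (simp_all add: FTot_def)

lemma in_Obj_Pyr: "P \<in> Obj (Pyr A) \<longleftrightarrow> is_pyramid A P"
  by (simp add: Pyr_def)

lemma pyr_ext_idem [simp]: "pyr_ext (pyr_ext \<alpha>) = pyr_ext \<alpha>"
  by (intro ext) (simp add: pyr_ext_def)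

lemma pyr_ext_Idx: "\<lbrakk>a \<in> Idx k; b \<in> Idx k\<rbrakk> \<Longrightarrow> pyr_ext \<alpha> k a b = \<alpha> k a b"
  by (simp add: pyr_ext_def)

lemma pyr_ext_eqI:
  assumes "pyr_ext \<alpha> = \<alpha>" "pyr_ext \<beta> = \<beta>"
    "\<And>k a b. \<lbrakk>a \<in> Idx k; b \<in> Idx k\<rbrakk> \<Longrightarrow> \<alpha> k a b = \<beta> k a b"
  shows "\<alpha> = \<beta>"
proof -
  have "pyr_ext \<alpha> = pyr_ext \<beta>" using assms(3) by (intro ext) (simp add: pyr_ext_def)
  then show ?thesis using assms(1,2) by simp
qed

context additive_category
begin

lemma category_Com_minus: "category (Com_minus A)"
proof
  show "Cmp (Com_minus A) M N L h g \<in> Hom (Com_minus A) M L"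
    if obj: "M \<in> Obj (Com_minus A)" "N \<in> Obj (Com_minus A)" "L \<in> Obj (Com_minus A)"
      and g: "g \<in> Hom (Com_minus A) M N" and h: "h \<in> Hom (Com_minus A) N L" for M N L g h
  proof -
    have [simp]: "cobj M k \<in> Obj A" "cobj N k \<in> Obj A" "cobj L k \<in> Obj A"
      "cdiff M k \<in> Hom A (cobj M k) (cobj M (k + 1))" "cdiff N k \<in> Hom A (cobj N k) (cobj N (k + 1))"
      "cdiff L k \<in> Hom A (cobj L k) (cobj L (k + 1))"
      "g k \<in> Hom A (cobj M k) (cobj N k)" "h k \<in> Hom A (cobj N k) (cobj L k)" for k
      using obj g h by (simp_all add: in_Obj_Com_minus is_complex_def in_Hom_Com_minus)
    have gc: "Cmp A (cobj M k) (cobj M (k + 1)) (cobj N (k + 1)) (g (k + 1)) (cdiff M k) =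
        Cmp A (cobj M k) (cobj N k) (cobj N (k + 1)) (cdiff N k) (g k)" for k
      using g by (simp add: in_Hom_Com_minus)
    have hc: "Cmp A (cobj N k) (cobj N (k + 1)) (cobj L (k + 1)) (h (k + 1)) (cdiff N k) =
        Cmp A (cobj N k) (cobj L k) (cobj L (k + 1)) (cdiff L k) (h k)" for k
      using h by (simp add: in_Hom_Com_minus)
    have "Cmp A (cobj M k) (cobj M (k + 1)) (cobj L (k + 1))
        (Cmp A (cobj M (k + 1)) (cobj N (k + 1)) (cobj L (k + 1)) (h (k + 1)) (g (k + 1))) (cdiff M k) =
      Cmp A (cobj M k) (cobj L k) (cobj L (k + 1)) (cdiff L k)
        (Cmp A (cobj M k) (cobj N k) (cobj L k) (h k) (g k))" for k
    proof -
      have "Cmp A (cobj M k) (cobj M (k + 1)) (cobj L (k + 1))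
          (Cmp A (cobj M (k + 1)) (cobj N (k + 1)) (cobj L (k + 1)) (h (k + 1)) (g (k + 1))) (cdiff M k) =
        Cmp A (cobj M k) (cobj N (k + 1)) (cobj L (k + 1)) (h (k + 1))
          (Cmp A (cobj M k) (cobj M (k + 1)) (cobj N (k + 1)) (g (k + 1)) (cdiff M k))"
        by (simp add: Cmp_assoc)
      also have "\<dots> = Cmp A (cobj M k) (cobj N k) (cobj L (k + 1))
          (Cmp A (cobj N k) (cobj N (k + 1)) (cobj L (k + 1)) (h (k + 1)) (cdiff N k)) (g k)"
        by (simp add: gc Cmp_assoc)
      also have "\<dots> = Cmp A (cobj M k) (cobj L k) (cobj L (k + 1)) (cdiff L k)
        (Cmp A (cobj M k) (cobj N k) (cobj L k) (h k) (g k))"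
        by (simp add: hc Cmp_assoc)
      finally show ?thesis .
    qed
    then show ?thesis by (simp add: in_Hom_Com_minus Cmp_Com_minus Cmp_in_Hom)
  qed
qed (auto simp: in_Obj_Com_minus in_Hom_Com_minus Cmp_Com_minus Idn_Com_minus is_complex_def
    Idn_in_Hom Cmp_Idn_left Cmp_Idn_right Cmp_assoc)

lemma FTot_obj:
  assumes P: "is_pyramid A P"
  shows "ObjMap (FTot A) P \<in> Obj (Com_minus A)"
proof -
  let ?X = "pobj P" and ?S = "\<lambda>k. ds_obj A (Idx k) (pobj P)"
  let ?d = "\<lambda>k. mat_mor A (Idx k) (pobj P) (Idx (k + 1)) (pobj P) (pmat A P)"
  note fam = finite_family_pobj[OF P]
  note [simp] = pobj_in_Obj[OF P] pmat_in_Hom[OF P] ds_obj_in_Obj[OF fam] mat_mor_in_Hom[OF fam fam]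
  have "Cmp A (?S k) (?S (k + 1)) (?S (k + 1 + 1)) (?d (k + 1)) (?d k) =
      hzero A (?S k) (?S (k + 1 + 1))" for k
  proof -
    have "Cmp A (?S k) (?S (k + 1)) (?S (k + 1 + 1)) (?d (k + 1)) (?d k) =
        mat_mor A (Idx k) ?X (Idx (k + 1 + 1)) ?X
          (mat_mult A (Idx (k + 1)) ?X ?X ?X (pmat A P) (pmat A P))"
      by (rule mat_mor_mult[OF fam fam fam, symmetric]) simp_all
    also have "\<dots> = hzero A (?S k) (?S (k + 1 + 1))"
      by (rule mat_mor_eqI[OF fam fam])
        (simp_all add: pmat_square[OF P] Cmp_hzero_left Cmp_hzero_right
          ds_inj_in_Hom[OF fam] ds_proj_in_Hom[OF fam])
    finally show ?thesis .
  qed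
  then have "is_complex A (ObjMap (FTot A) P)"
    by (simp add: is_complex_def FTot_simps add.assoc)
  moreover obtain K where K: "\<And>k a. \<lbrakk>k \<ge> K; a \<in> Idx k\<rbrakk> \<Longrightarrow> is_zero_object A (?X a)"
    using pyramid_zero_above[OF P] by blast
  have "is_zero_object A (?S k)" if "k \<ge> K" for k
  proof -
    have "Idn A (?S k) = hzero A (?S k) (?S k)"
      unfolding ds_sum_Idn[OF fam, symmetric]
      by (rule hsum_zero)
        (simp_all add: K[OF that] Cmp_zero_object ds_inj_in_Hom[OF fam] ds_proj_in_Hom[OF fam])
    then show ?thesis by (simp add: is_zero_object_iff)
  qed
  ultimately show ?thesis by (auto simp: in_Obj_Com_minus FTot_simps)
qed

text \<open>
  A family of matrices commutes with the differentials of two pyramids iff the family of morphisms of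
  direct sums that it defines commutes with the differentials of the total complexes.
\<close>

lemma in_Hom_Pyr_iff:
  assumes P: "is_pyramid A P" and Q: "is_pyramid A Q"
  shows "\<alpha> \<in> Hom (Pyr A) P Q \<longleftrightarrow> pyr_ext \<alpha> = \<alpha> \<and>
    (\<forall>k. \<forall>a \<in> Idx k. \<forall>b \<in> Idx k. \<alpha> k a b \<in> Hom A (pobj P b) (pobj Q a)) \<and>
    MorMap (FTot A) P Q \<alpha> \<in> Hom (Com_minus A) (ObjMap (FTot A) P) (ObjMap (FTot A) Q)"
proof (cases "\<forall>k. \<forall>a \<in> Idx k. \<forall>b \<in> Idx k. \<alpha> k a b \<in> Hom A (pobj P b) (pobj Q a)")
  case True
  then have \<alpha>: "\<alpha> k a b \<in> Hom A (pobj P b) (pobj Q a)" if "a \<in> Idx k" "b \<in> Idx k" for k a b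
    using that by blast
  note famP = finite_family_pobj[OF P] and famQ = finite_family_pobj[OF Q]
  have "(\<forall>a \<in> Idx (k + 1). \<forall>b \<in> Idx k.
      mat_mult A (Idx (k + 1)) (pobj P) (pobj P) (pobj Q) (\<alpha> (k + 1)) (pmat A P) a b =
      mat_mult A (Idx k) (pobj P) (pobj Q) (pobj Q) (pmat A Q) (\<alpha> k) a b) \<longleftrightarrow>
    Cmp A (ds_obj A (Idx k) (pobj P)) (ds_obj A (Idx (k + 1)) (pobj P)) (ds_obj A (Idx (k + 1)) (pobj Q))
      (mat_mor A (Idx (k + 1)) (pobj P) (Idx (k + 1)) (pobj Q) (\<alpha> (k + 1)))
      (mat_mor A (Idx k) (pobj P) (Idx (k + 1)) (pobj P) (pmat A P)) =
    Cmp A (ds_obj A (Idx k) (pobj P)) (ds_obj A (Idx k) (pobj Q)) (ds_obj A (Idx (k + 1)) (pobj Q))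
      (mat_mor A (Idx k) (pobj Q) (Idx (k + 1)) (pobj Q) (pmat A Q))
      (mat_mor A (Idx k) (pobj P) (Idx k) (pobj Q) (\<alpha> k))" (is "?mat \<longleftrightarrow> ?mor") for k
  proof
    assume ?mat
    then have "mat_mor A (Idx k) (pobj P) (Idx (k + 1)) (pobj Q)
        (mat_mult A (Idx (k + 1)) (pobj P) (pobj P) (pobj Q) (\<alpha> (k + 1)) (pmat A P)) =
      mat_mor A (Idx k) (pobj P) (Idx (k + 1)) (pobj Q)
        (mat_mult A (Idx k) (pobj P) (pobj Q) (pobj Q) (pmat A Q) (\<alpha> k))"
      by (intro mat_mor_cong[OF famP famQ] mat_mult_in_Hom[OF famP famQ famQ])
        (auto simp: pmat_in_Hom[OF Q] \<alpha>)
    then show ?mor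
      by (simp add: mat_mor_mult[OF famP famP famQ] mat_mor_mult[OF famP famQ famQ]
          pmat_in_Hom[OF P] pmat_in_Hom[OF Q] \<alpha>)
  next
    assume ?mor
    then show ?mat
      by (intro ballI) (simp add: mat_mult_eq_entry[OF famP[of k] famP famQ[of "k + 1"]]
          mat_mult_eq_entry[OF famP[of k] famQ famQ[of "k + 1"]] pmat_in_Hom[OF P] pmat_in_Hom[OF Q] \<alpha>)
  qed
  then show ?thesis
    using True mat_mor_in_Hom[OF famP famQ \<alpha>] by (simp add: Pyr_def in_Hom_Com_minus FTot_simps)
next
  case False
  then show ?thesis by (simp add: Pyr_def) blast
qed

text \<open>The inverse bijection takes a morphism of total complexes to the matrices of its components.\<close>

lemma FTot_Hom_bij:
  assumes P: "is_pyramid A P" and Q: "is_pyramid A Q"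
  shows "bij_betw (MorMap (FTot A) P Q) (Hom (Pyr A) P Q)
    (Hom (Com_minus A) (ObjMap (FTot A) P) (ObjMap (FTot A) Q))"
proof -
  note famP = finite_family_pobj[OF P] and famQ = finite_family_pobj[OF Q]
  let ?S = "\<lambda>k. ds_obj A (Idx k) (pobj P)" and ?T = "\<lambda>k. ds_obj A (Idx k) (pobj Q)"
  let ?entry = "\<lambda>f k a b. Cmp A (pobj P b) (?T k) (pobj Q a) (ds_proj A (Idx k) (pobj Q) a)
    (Cmp A (pobj P b) (?S k) (?T k) f (ds_inj A (Idx k) (pobj P) b))"
  have "inj_on (MorMap (FTot A) P Q) (Hom (Pyr A) P Q)"
  proof (rule inj_onI)
    fix \<alpha> \<beta> assume "\<alpha> \<in> Hom (Pyr A) P Q" "\<beta> \<in> Hom (Pyr A) P Q"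
      and eq: "MorMap (FTot A) P Q \<alpha> = MorMap (FTot A) P Q \<beta>"
    then have ext: "pyr_ext \<alpha> = \<alpha>" "pyr_ext \<beta> = \<beta>"
      and \<alpha>: "\<And>k a b. \<lbrakk>a \<in> Idx k; b \<in> Idx k\<rbrakk> \<Longrightarrow> \<alpha> k a b \<in> Hom A (pobj P b) (pobj Q a)"
      and \<beta>: "\<And>k a b. \<lbrakk>a \<in> Idx k; b \<in> Idx k\<rbrakk> \<Longrightarrow> \<beta> k a b \<in> Hom A (pobj P b) (pobj Q a)"
      using in_Hom_Pyr_iff[OF P Q] by blast+
    show "\<alpha> = \<beta>"
    proof (rule pyr_ext_eqI[OF ext])
      fix k a b assume ab: "a \<in> Idx k" "b \<in> Idx k"
      have "mat_mor A (Idx k) (pobj P) (Idx k) (pobj Q) (\<alpha> k) =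
          mat_mor A (Idx k) (pobj P) (Idx k) (pobj Q) (\<beta> k)"
        using fun_cong[OF eq, of k] by (simp add: FTot_simps)
      then show "\<alpha> k a b = \<beta> k a b"
        using mat_mor_entry[where \<alpha> = "\<alpha> k", OF famP famQ \<alpha> ab]
          mat_mor_entry[where \<alpha> = "\<beta> k", OF famP famQ \<beta> ab] by simp
    qed
  qed
  moreover have "\<exists>\<alpha> \<in> Hom (Pyr A) P Q. MorMap (FTot A) P Q \<alpha> = g"
    if g: "g \<in> Hom (Com_minus A) (ObjMap (FTot A) P) (ObjMap (FTot A) Q)" for g
  proof -
    have gk: "g k \<in> Hom A (?S k) (?T k)" for k
      using g by (simp add: in_Hom_Com_minus FTot_simps)
    define \<alpha> where "\<alpha> = pyr_ext (\<lambda>k. ?entry (g k) k)"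
    have \<alpha>_eq: "\<alpha> k a b = ?entry (g k) k a b" if "a \<in> Idx k" "b \<in> Idx k" for k a b
      using that by (simp add: \<alpha>_def pyr_ext_Idx)
    have \<alpha>: "\<alpha> k a b \<in> Hom A (pobj P b) (pobj Q a)" if "a \<in> Idx k" "b \<in> Idx k" for k a b
      unfolding \<alpha>_eq[OF that]
      using that gk pobj_in_Obj[OF P] pobj_in_Obj[OF Q]
      by (simp add: Cmp_in_Hom ds_obj_in_Obj[OF famP] ds_obj_in_Obj[OF famQ]
          ds_inj_in_Hom[OF famP] ds_proj_in_Hom[OF famQ])
    have "mat_mor A (Idx k) (pobj P) (Idx k) (pobj Q) (\<alpha> k) = g k" for k
      by (rule mat_mor_eqI[OF famP famQ \<alpha> gk]) (simp_all add: \<alpha>_eq)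
    then have "MorMap (FTot A) P Q \<alpha> = g" by (simp add: FTot_simps)
    moreover have "\<alpha> \<in> Hom (Pyr A) P Q"
      unfolding in_Hom_Pyr_iff[OF P Q] \<open>MorMap (FTot A) P Q \<alpha> = g\<close>
      using \<alpha> g by (simp add: \<alpha>_def)
    ultimately show ?thesis by blast
  qed
  moreover have "MorMap (FTot A) P Q ` Hom (Pyr A) P Q \<subseteq>
      Hom (Com_minus A) (ObjMap (FTot A) P) (ObjMap (FTot A) Q)"
    using in_Hom_Pyr_iff[OF P Q] by blast
  ultimately show ?thesis unfolding bij_betw_def by blast
qed

lemma FTot_Idn:
  assumes P: "is_pyramid A P"
  shows "MorMap (FTot A) P P (Idn (Pyr A) P) = Idn (Com_minus A) (ObjMap (FTot A) P)"
proof (rule ext)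
  fix k
  note fam = finite_family_pobj[OF P, of k]
  have "mat_mor A (Idx k) (pobj P) (Idx k) (pobj P) (Idn (Pyr A) P k) =
      mat_mor A (Idx k) (pobj P) (Idx k) (pobj P)
        (\<lambda>a b. if a = b then Idn A (pobj P a) else hzero A (pobj P b) (pobj P a))"
    by (rule mat_mor_cong[OF fam fam])
      (auto simp: Pyr_def pyr_ext_Idx Idn_in_Hom pobj_in_Obj[OF P])
  then show "MorMap (FTot A) P P (Idn (Pyr A) P) k = Idn (Com_minus A) (ObjMap (FTot A) P) k"
    by (simp add: FTot_simps Idn_Com_minus mat_mor_Idn[OF fam])
qed

lemma Idn_in_Hom_Pyr:
  assumes P: "is_pyramid A P"
  shows "Idn (Pyr A) P \<in> Hom (Pyr A) P P"
  unfolding in_Hom_Pyr_iff[OF P P] FTot_Idn[OF P]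
  using category.Idn_in_Hom[OF category_Com_minus FTot_obj[OF P]]
  by (auto simp: Pyr_def pyr_ext_Idx Idn_in_Hom pobj_in_Obj[OF P])

lemma FTot_Cmp:
  assumes P: "is_pyramid A P" and Q: "is_pyramid A Q" and R: "is_pyramid A R"
    and "\<alpha> \<in> Hom (Pyr A) P Q" "\<beta> \<in> Hom (Pyr A) Q R"
  shows "MorMap (FTot A) P R (Cmp (Pyr A) P Q R \<beta> \<alpha>) =
    Cmp (Com_minus A) (ObjMap (FTot A) P) (ObjMap (FTot A) Q) (ObjMap (FTot A) R)
      (MorMap (FTot A) Q R \<beta>) (MorMap (FTot A) P Q \<alpha>)" (is ?F)
    and "Cmp (Pyr A) P Q R \<beta> \<alpha> \<in> Hom (Pyr A) P R" (is ?H)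
proof -
  note fam = finite_family_pobj[OF P] finite_family_pobj[OF Q] finite_family_pobj[OF R]
  have \<alpha>: "\<And>k a b. \<lbrakk>a \<in> Idx k; b \<in> Idx k\<rbrakk> \<Longrightarrow> \<alpha> k a b \<in> Hom A (pobj P b) (pobj Q a)"
    and \<beta>: "\<And>k a b. \<lbrakk>a \<in> Idx k; b \<in> Idx k\<rbrakk> \<Longrightarrow> \<beta> k a b \<in> Hom A (pobj Q b) (pobj R a)"
    using in_Hom_Pyr_iff[OF P Q] in_Hom_Pyr_iff[OF Q R] assms(4,5) by blast+
  have entry: "Cmp (Pyr A) P Q R \<beta> \<alpha> k a b =
      mat_mult A (Idx k) (pobj P) (pobj Q) (pobj R) (\<beta> k) (\<alpha> k) a b"
    if "a \<in> Idx k" "b \<in> Idx k" for k a b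
    using that by (simp add: Pyr_def pyr_ext_Idx)
  have hom: "mat_mult A (Idx k) (pobj P) (pobj Q) (pobj R) (\<beta> k) (\<alpha> k) a b \<in> Hom A (pobj P b) (pobj R a)"
    if "a \<in> Idx k" "b \<in> Idx k" for k a b
    by (rule mat_mult_in_Hom[OF fam \<alpha> \<beta> that])
  have "mat_mor A (Idx k) (pobj P) (Idx k) (pobj R) (Cmp (Pyr A) P Q R \<beta> \<alpha> k) =
      mat_mor A (Idx k) (pobj P) (Idx k) (pobj R)
        (mat_mult A (Idx k) (pobj P) (pobj Q) (pobj R) (\<beta> k) (\<alpha> k))" for k
    by (rule mat_mor_cong[OF fam(1,3) hom entry])
  then show ?F
    by (simp add: FTot_simps Cmp_Com_minus mat_mor_mult[OF fam] \<alpha> \<beta>)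
  have "MorMap (FTot A) P R (Cmp (Pyr A) P Q R \<beta> \<alpha>) \<in>
      Hom (Com_minus A) (ObjMap (FTot A) P) (ObjMap (FTot A) R)"
    unfolding \<open>?F\<close>
    using in_Hom_Pyr_iff[OF P Q] in_Hom_Pyr_iff[OF Q R] assms(4,5) FTot_obj[OF P] FTot_obj[OF Q]
      FTot_obj[OF R] by (intro category.Cmp_in_Hom[OF category_Com_minus]) auto
  moreover have "pyr_ext (Cmp (Pyr A) P Q R \<beta> \<alpha>) = Cmp (Pyr A) P Q R \<beta> \<alpha>"
    by (simp add: Pyr_def)
  ultimately show ?H
    unfolding in_Hom_Pyr_iff[OF P R] using entry hom by simp
qed


section \<open>Complexes as pyramids\<close>

lemma Incl_simps:
  "pobj (ObjMap (Incl A) M) = incl_obj A M"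
  "pdiff (ObjMap (Incl A) M) = (\<lambda>a i. if a = axis (ht a) \<and> i = 0 then cdiff M (ht a)
    else hzero A (incl_obj A M a) (incl_obj A M (a + eps i)))"
  "pdim (ObjMap (Incl A) M) = 1"
  by (simp_all add: Incl_def)

lemma incl_obj_axis [simp]: "incl_obj A M (axis k) = cobj M k"
  by (simp add: incl_obj_def)

lemma is_zero_incl_obj: "a \<noteq> axis (ht a) \<Longrightarrow> is_zero_object A (incl_obj A M a)"
  by (simp add: incl_obj_def is_zero_object_zero_obj)

lemma incl_obj_in_Obj: "is_complex A M \<Longrightarrow> incl_obj A M a \<in> Obj A"
  by (simp add: incl_obj_def is_complex_def)

lemma Incl_obj:
  assumes "M \<in> Obj (Com_minus A)"
  shows "is_pyramid A (ObjMap (Incl A) M)"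
proof -
  let ?X = "incl_obj A M" and ?d = "pdiff (ObjMap (Incl A) M)"
  have M: "is_complex A M" using assms by (simp add: in_Obj_Com_minus)
  obtain K where K: "\<And>k. k \<ge> K \<Longrightarrow> is_zero_object A (cobj M k)"
    using assms by (auto simp: in_Obj_Com_minus)
  note [simp] = incl_obj_in_Obj[OF M]
  have d_axis: "?d (axis k) 0 = cdiff M k" for k by (simp add: Incl_simps)
  have d_zero: "?d a i = hzero A (?X a) (?X (a + eps i))" if "\<not> (a = axis (ht a) \<and> i = 0)" for a i
    using that by (auto simp: Incl_simps)
  have d: "?d a i \<in> Hom A (?X a) (?X (a + eps i))" for a i
  proof (cases "a = axis (ht a) \<and> i = 0")
    case True
    then obtain k where "a = axis k" "i = 0" by blast
    then show ?thesis using M by (simp add: d_axis is_complex_def)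
  qed (simp add: d_zero)
  \<comment> \<open>A composite of two differentials vanishes: either both lie on the axis and are differentials of
    the complex, or one of them is zero. So anticommutativity amounts to \<open>0 = - 0\<close>.\<close>
  have comp: "Cmp A (?X a) (?X (a + eps i)) (?X (a + eps i + eps j)) (?d (a + eps i) j) (?d a i) =
      hzero A (?X a) (?X (a + eps i + eps j))" for a i j
  proof (cases "a = axis (ht a) \<and> i = 0")
    case a: True
    then obtain k where k: "a = axis k" by blast
    show ?thesis
    proof (cases "j = 0")
      case True
      then show ?thesis using M a by (simp add: k d_axis is_complex_def add.assoc)
    next
      case False
      then show ?thesis using d[of a i] by (simp add: d_zero Cmp_hzero_left)
    qed
  next
    case False
    then show ?thesis using d[of "a + eps i" j] by (simp add: d_zero Cmp_hzero_right)
  qed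
  have "Cmp A (?X a) (?X (a + eps i)) (?X (a + eps i + eps j)) (?d (a + eps i) j) (?d a i) =
      inv\<^bsub>HomG A (?X a) (?X (a + eps i + eps j))\<^esub>
        (Cmp A (?X a) (?X (a + eps j)) (?X (a + eps j + eps i)) (?d (a + eps j) i) (?d a j))" for a i j
  proof -
    interpret comm_group "HomG A (?X a) (?X (a + eps i + eps j))" by (simp add: HomG_comm_group)
    have "a + eps j + eps i = a + eps i + eps j" by (simp add: ac_simps)
    then show ?thesis unfolding comp by (simp only: inv_one[unfolded HomG_simps])
  qed
  moreover have "is_zero_object A (?X a)" if "\<not> (\<forall>i \<ge> 1. Poly_Mapping.lookup a i = 0)" for a
  proof (rule is_zero_incl_obj)
    show "a \<noteq> axis (ht a)"
    proof
      assume "a = axis (ht a)"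
      moreover have "\<forall>i \<ge> 1. Poly_Mapping.lookup (axis k) i = 0" for k
        by (simp add: axis_def lookup_single)
      ultimately show False using that by metis
    qed
  qed
  moreover have "is_zero_object A (?X a)" if big: "\<not> (\<forall>i. Poly_Mapping.lookup a i < max K 1)" for a
  proof (cases "a = axis (ht a)")
    case True
    then obtain k where k: "a = axis k" by blast
    obtain i where "Poly_Mapping.lookup a i \<ge> max K 1" using big by (auto simp: not_less)
    then have "k \<ge> K" by (auto simp: k axis_def lookup_single when_def split: if_splits)
    then show ?thesis using K by (simp add: k)
  qed (rule is_zero_incl_obj)
  ultimately show ?thesis
    unfolding is_pyramid_def Let_def Incl_simps(1,3) using d comp incl_obj_in_Obj[OF M] by blast
qed

text \<open>
  The total complex of an included complex lives on the summand at \<open>axis k\<close> in degree \<open>k\<close>;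
  its injection and projection are mutually inverse.
\<close>

lemma finite_family_incl_obj: "M \<in> Obj (Com_minus A) \<Longrightarrow> finite_family A (Idx k) (incl_obj A M)"
  using finite_family_pobj[OF Incl_obj] by (simp add: Incl_simps)

lemma axis_inj_proj:
  assumes "M \<in> Obj (Com_minus A)"
  shows "Cmp A (ds_obj A (Idx k) (incl_obj A M)) (cobj M k) (ds_obj A (Idx k) (incl_obj A M))
    (ds_inj A (Idx k) (incl_obj A M) (axis k)) (ds_proj A (Idx k) (incl_obj A M) (axis k)) =
    Idn A (ds_obj A (Idx k) (incl_obj A M))"
proof -
  let ?X = "incl_obj A M" and ?S = "ds_obj A (Idx k) (incl_obj A M)"
  note fam = finite_family_incl_obj[OF assms, of k]
  note [simp] = finite_familyD[OF fam] ds_obj_in_Obj[OF fam] ds_inj_in_Hom[OF fam] ds_proj_in_Hom[OF fam]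
  have "Idn A ?S = hsum A ?S ?S
      (\<lambda>a. Cmp A ?S (?X a) ?S (ds_inj A (Idx k) ?X a) (ds_proj A (Idx k) ?X a)) (Idx k)"
    using ds_sum_Idn[OF fam] by simp
  also have "\<dots> = Cmp A ?S (?X (axis k)) ?S (ds_inj A (Idx k) ?X (axis k)) (ds_proj A (Idx k) ?X (axis k))"
  proof (rule hsum_single)
    fix a assume "a \<in> Idx k" "a \<noteq> axis k"
    moreover from this have "a \<noteq> axis (ht a)" by (auto simp: Idx_def)
    ultimately show "Cmp A ?S (?X a) ?S (ds_inj A (Idx k) ?X a) (ds_proj A (Idx k) ?X a) = hzero A ?S ?S"
      by (intro Cmp_zero_object is_zero_incl_obj) simp_all
  qed (simp_all add: Cmp_in_Hom del: incl_obj_axis)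
  finally show ?thesis by simp
qed

lemma FTot_Incl_diff:
  assumes "M \<in> Obj (Com_minus A)"
  shows "cdiff (ObjMap (FTot A) (ObjMap (Incl A) M)) k =
    Cmp A (ds_obj A (Idx k) (incl_obj A M)) (cobj M (k + 1)) (ds_obj A (Idx (k + 1)) (incl_obj A M))
      (ds_inj A (Idx (k + 1)) (incl_obj A M) (axis (k + 1)))
      (Cmp A (ds_obj A (Idx k) (incl_obj A M)) (cobj M k) (cobj M (k + 1)) (cdiff M k)
        (ds_proj A (Idx k) (incl_obj A M) (axis k)))"
proof -
  let ?X = "incl_obj A M" and ?P = "ObjMap (Incl A) M"
  note fam = finite_family_incl_obj[OF assms]
  have M: "is_complex A M" using assms by (simp add: in_Obj_Com_minus)
  have f: "cdiff M k \<in> Hom A (?X (axis k)) (?X (axis (k + 1)))"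
    using M by (simp add: is_complex_def)
  have entry: "pmat A ?P a b =
      (if a = axis (k + 1) \<and> b = axis k then cdiff M k else hzero A (?X b) (?X a))"
    if "a \<in> Idx (k + 1)" "b \<in> Idx k" for a b
  proof (cases "\<exists>i. a = b + eps i")
    case True
    then obtain i where a: "a = b + eps i" by blast
    have b: "ht b = k" using that by (simp add: Idx_def)
    show ?thesis
    proof (cases "b = axis k \<and> i = 0")
      case True
      moreover have "pmat A ?P (axis k + eps 0) (axis k) = cdiff M k"
        unfolding pmat_eps by (simp add: Incl_simps)
      ultimately show ?thesis by (simp add: a)
    next
      case False
      then have "\<not> (a = axis (k + 1) \<and> b = axis k)"
        using a by (metis add_left_imp_eq axis_add_eps eps_inject)
      moreover have "pmat A ?P a b = hzero A (?X b) (?X a)"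
        unfolding a pmat_eps using False by (auto simp: b Incl_simps)
      ultimately show ?thesis by (simp only: if_False)
    qed
  next
    case False
    then have "\<not> (a = axis (k + 1) \<and> b = axis k)" by (metis axis_add_eps)
    then show ?thesis using False pmat_eq_hzero[of a b ?P] by (auto simp: Incl_simps)
  qed
  have "cdiff (ObjMap (FTot A) ?P) k = mat_mor A (Idx k) ?X (Idx (k + 1)) ?X
      (\<lambda>a b. if a = axis (k + 1) \<and> b = axis k then cdiff M k else hzero A (?X b) (?X a))"
    unfolding FTot_simps Incl_simps(1)
    by (rule mat_mor_cong[OF fam fam]) (use f incl_obj_in_Obj[OF M] in \<open>auto simp: entry\<close>)
  also have "\<dots> = Cmp A (ds_obj A (Idx k) ?X) (?X (axis (k + 1))) (ds_obj A (Idx (k + 1)) ?X)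
      (ds_inj A (Idx (k + 1)) ?X (axis (k + 1)))
      (Cmp A (ds_obj A (Idx k) ?X) (?X (axis k)) (?X (axis (k + 1))) (cdiff M k)
        (ds_proj A (Idx k) ?X (axis k)))"
    by (rule mat_mor_single[OF fam fam _ _ f]) simp_all
  finally show ?thesis by simp
qed

lemma FTot_Incl_mor:
  assumes "M \<in> Obj (Com_minus A)" "N \<in> Obj (Com_minus A)" "g \<in> Hom (Com_minus A) M N"
  shows "MorMap (FTot A) (ObjMap (Incl A) M) (ObjMap (Incl A) N) (MorMap (Incl A) M N g) k =
    Cmp A (ds_obj A (Idx k) (incl_obj A M)) (cobj N k) (ds_obj A (Idx k) (incl_obj A N))
      (ds_inj A (Idx k) (incl_obj A N) (axis k))
      (Cmp A (ds_obj A (Idx k) (incl_obj A M)) (cobj M k) (cobj N k) (g k)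
        (ds_proj A (Idx k) (incl_obj A M) (axis k)))"
proof -
  let ?X = "incl_obj A M" and ?Y = "incl_obj A N"
  note fam = finite_family_incl_obj[OF assms(1)] finite_family_incl_obj[OF assms(2)]
  have MN: "is_complex A M" "is_complex A N" using assms by (simp_all add: in_Obj_Com_minus)
  have g: "g k \<in> Hom A (?X (axis k)) (?Y (axis k))"
    using assms(3) by (simp add: in_Hom_Com_minus)
  have "mat_mor A (Idx k) ?X (Idx k) ?Y (MorMap (Incl A) M N g k) = mat_mor A (Idx k) ?X (Idx k) ?Y
      (\<lambda>a b. if a = axis k \<and> b = axis k then g k else hzero A (?X b) (?Y a))"
    by (rule mat_mor_cong[OF fam])
      (use g MN in \<open>auto simp: Incl_def pyr_ext_Idx incl_obj_in_Obj\<close>)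
  also have "\<dots> = Cmp A (ds_obj A (Idx k) ?X) (?Y (axis k)) (ds_obj A (Idx k) ?Y)
      (ds_inj A (Idx k) ?Y (axis k))
      (Cmp A (ds_obj A (Idx k) ?X) (?X (axis k)) (?Y (axis k)) (g k) (ds_proj A (Idx k) ?X (axis k)))"
    by (rule mat_mor_single[OF fam _ _ g]) simp_all
  finally show ?thesis by (simp add: FTot_simps Incl_simps)
qed

lemma axis_maps:
  assumes "M \<in> Obj (Com_minus A)"
  shows "ds_obj A (Idx k) (incl_obj A M) \<in> Obj A"
    and "ds_inj A (Idx k) (incl_obj A M) (axis k) \<in> Hom A (cobj M k) (ds_obj A (Idx k) (incl_obj A M))"
    and "ds_proj A (Idx k) (incl_obj A M) (axis k) \<in> Hom A (ds_obj A (Idx k) (incl_obj A M)) (cobj M k)"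
    and "Cmp A (cobj M k) (ds_obj A (Idx k) (incl_obj A M)) (cobj M k)
      (ds_proj A (Idx k) (incl_obj A M) (axis k)) (ds_inj A (Idx k) (incl_obj A M) (axis k)) =
      Idn A (cobj M k)"
proof -
  note fam = finite_family_incl_obj[OF assms, of k]
  show "ds_obj A (Idx k) (incl_obj A M) \<in> Obj A" by (rule ds_obj_in_Obj[OF fam])
  show "ds_inj A (Idx k) (incl_obj A M) (axis k) \<in> Hom A (cobj M k) (ds_obj A (Idx k) (incl_obj A M))"
    using ds_inj_in_Hom[OF fam axis_in_Idx] by simp
  show "ds_proj A (Idx k) (incl_obj A M) (axis k) \<in> Hom A (ds_obj A (Idx k) (incl_obj A M)) (cobj M k)"
    using ds_proj_in_Hom[OF fam axis_in_Idx] by simp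
  show "Cmp A (cobj M k) (ds_obj A (Idx k) (incl_obj A M)) (cobj M k)
      (ds_proj A (Idx k) (incl_obj A M) (axis k)) (ds_inj A (Idx k) (incl_obj A M) (axis k)) =
      Idn A (cobj M k)"
    using ds_proj_inj[OF fam axis_in_Idx axis_in_Idx] by simp
qed

lemma complexD:
  assumes "M \<in> Obj (Com_minus A)"
  shows "cobj M k \<in> Obj A" "cdiff M k \<in> Hom A (cobj M k) (cobj M (k + 1))"
  using assms by (simp_all add: in_Obj_Com_minus is_complex_def)

lemma Incl_Hom:
  assumes M: "M \<in> Obj (Com_minus A)" and N: "N \<in> Obj (Com_minus A)"
    and g: "g \<in> Hom (Com_minus A) M N"
  shows "MorMap (Incl A) M N g \<in> Hom (Pyr A) (ObjMap (Incl A) M) (ObjMap (Incl A) N)"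
proof -
  let ?S = "\<lambda>k. ds_obj A (Idx k) (incl_obj A M)" and ?T = "\<lambda>k. ds_obj A (Idx k) (incl_obj A N)"
  let ?p = "\<lambda>k. ds_proj A (Idx k) (incl_obj A M) (axis k)"
  let ?q = "\<lambda>k. ds_inj A (Idx k) (incl_obj A N) (axis k)"
  have gk: "g k \<in> Hom A (cobj M k) (cobj N k)"
    and gc: "Cmp A (cobj M k) (cobj M (k + 1)) (cobj N (k + 1)) (g (k + 1)) (cdiff M k) =
      Cmp A (cobj M k) (cobj N k) (cobj N (k + 1)) (cdiff N k) (g k)" for k
    using g by (simp_all add: in_Hom_Com_minus)
  note [simp] = complexD[OF M] complexD[OF N] axis_maps(1-3)[OF M] axis_maps(1-3)[OF N] gk
  have "MorMap (FTot A) (ObjMap (Incl A) M) (ObjMap (Incl A) N) (MorMap (Incl A) M N g)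
      \<in> Hom (Com_minus A) (ObjMap (FTot A) (ObjMap (Incl A) M)) (ObjMap (FTot A) (ObjMap (Incl A) N))"
    unfolding in_Hom_Com_minus FTot_Incl_mor[OF M N g] FTot_Incl_diff[OF M] FTot_Incl_diff[OF N]
      FTot_simps(1) Incl_simps(1)
  proof (intro conjI allI)
    fix k
    show "Cmp A (?S k) (cobj N k) (?T k) (?q k) (Cmp A (?S k) (cobj M k) (cobj N k) (g k) (?p k))
        \<in> Hom A (?S k) (?T k)"
      by (simp add: Cmp_in_Hom)
    let ?i = "ds_inj A (Idx (k + 1)) (incl_obj A M) (axis (k + 1))"
    let ?r = "ds_proj A (Idx k) (incl_obj A N) (axis k)"
    \<comment> \<open>\<open>F I M\<close> and \<open>F I N\<close> have differentials \<open>\<iota> f \<pi>\<close>, and \<open>g\<close> becomes \<open>\<iota> g \<pi>\<close>; so both composites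
      reduce by \<open>\<pi> \<iota> = id\<close> to \<open>\<iota> (g f) \<pi> = \<iota> (f g) \<pi>\<close>.\<close>
    have "Cmp A (?S k) (?S (k + 1)) (?T (k + 1))
        (Cmp A (?S (k + 1)) (cobj N (k + 1)) (?T (k + 1)) (?q (k + 1))
          (Cmp A (?S (k + 1)) (cobj M (k + 1)) (cobj N (k + 1)) (g (k + 1)) (?p (k + 1))))
        (Cmp A (?S k) (cobj M (k + 1)) (?S (k + 1)) ?i
          (Cmp A (?S k) (cobj M k) (cobj M (k + 1)) (cdiff M k) (?p k))) =
      Cmp A (?S k) (cobj N (k + 1)) (?T (k + 1)) (?q (k + 1))
        (Cmp A (?S k) (cobj M (k + 1)) (cobj N (k + 1)) (g (k + 1))
          (Cmp A (?S k) (cobj M (k + 1)) (cobj M (k + 1))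
            (Cmp A (cobj M (k + 1)) (?S (k + 1)) (cobj M (k + 1)) (?p (k + 1)) ?i)
            (Cmp A (?S k) (cobj M k) (cobj M (k + 1)) (cdiff M k) (?p k))))"
      by (simp add: Cmp_assoc Cmp_in_Hom)
    also have "\<dots> = Cmp A (?S k) (cobj N (k + 1)) (?T (k + 1)) (?q (k + 1))
        (Cmp A (?S k) (cobj M k) (cobj N (k + 1))
          (Cmp A (cobj M k) (cobj M (k + 1)) (cobj N (k + 1)) (g (k + 1)) (cdiff M k)) (?p k))"
      by (simp add: Cmp_assoc Cmp_in_Hom axis_maps(4)[OF M] Cmp_Idn_left)
    also have "\<dots> = Cmp A (?S k) (cobj N (k + 1)) (?T (k + 1)) (?q (k + 1))
        (Cmp A (?S k) (cobj N k) (cobj N (k + 1)) (cdiff N k)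
          (Cmp A (?S k) (cobj M k) (cobj N k)
            (Cmp A (cobj M k) (cobj N k) (cobj N k)
              (Cmp A (cobj N k) (?T k) (cobj N k) ?r (?q k)) (g k)) (?p k)))"
      by (simp add: axis_maps(4)[OF N] gc Cmp_assoc Cmp_in_Hom Cmp_Idn_left)
    also have "\<dots> = Cmp A (?S k) (?T k) (?T (k + 1))
        (Cmp A (?T k) (cobj N (k + 1)) (?T (k + 1)) (?q (k + 1))
          (Cmp A (?T k) (cobj N k) (cobj N (k + 1)) (cdiff N k) ?r))
        (Cmp A (?S k) (cobj N k) (?T k) (?q k) (Cmp A (?S k) (cobj M k) (cobj N k) (g k) (?p k)))"
      by (simp add: Cmp_assoc Cmp_in_Hom)
    finally show "Cmp A (?S k) (?S (k + 1)) (?T (k + 1))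
        (Cmp A (?S (k + 1)) (cobj N (k + 1)) (?T (k + 1)) (?q (k + 1))
          (Cmp A (?S (k + 1)) (cobj M (k + 1)) (cobj N (k + 1)) (g (k + 1)) (?p (k + 1))))
        (Cmp A (?S k) (cobj M (k + 1)) (?S (k + 1)) ?i
          (Cmp A (?S k) (cobj M k) (cobj M (k + 1)) (cdiff M k) (?p k))) = \<dots>" .
  qed
  moreover have "pyr_ext (MorMap (Incl A) M N g) = MorMap (Incl A) M N g"
    by (simp add: Incl_def)
  moreover have "MorMap (Incl A) M N g k a b \<in> Hom A (incl_obj A M b) (incl_obj A N a)"
    if "a \<in> Idx k" "b \<in> Idx k" for k a b
    using that M N by (auto simp: Incl_def pyr_ext_Idx incl_obj_in_Obj in_Obj_Com_minus)
  ultimately show ?thesis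
    unfolding in_Hom_Pyr_iff[OF Incl_obj[OF M] Incl_obj[OF N]] Incl_simps(1) by blast
qed

lemma FTot_Incl_natural_iso:
  "natural_iso (Com_minus A) (Com_minus A) (comp_functor (FTot A) (Incl A)) id_functor
    (\<lambda>M k. ds_proj A (Idx k) (incl_obj A M) (axis k))"
proof -
  let ?S = "\<lambda>M k. ds_obj A (Idx k) (incl_obj A M)"
  let ?p = "\<lambda>M k. ds_proj A (Idx k) (incl_obj A M) (axis k)"
  let ?i = "\<lambda>M k. ds_inj A (Idx k) (incl_obj A M) (axis k)"
  let ?FI = "\<lambda>M. ObjMap (FTot A) (ObjMap (Incl A) M)"
  have cobj: "cobj (?FI M) k = ?S M k" for M k by (simp add: FTot_simps Incl_simps)
  have iso: "is_iso (Com_minus A) (?FI M) M (?p M)" if M: "M \<in> Obj (Com_minus A)" for M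
  proof -
    note [simp] = complexD[OF M] axis_maps[OF M]
    have "Cmp A (?S M k) (?S M (k + 1)) (cobj M (k + 1)) (?p M (k + 1))
        (Cmp A (?S M k) (cobj M (k + 1)) (?S M (k + 1)) (?i M (k + 1))
          (Cmp A (?S M k) (cobj M k) (cobj M (k + 1)) (cdiff M k) (?p M k))) =
      Cmp A (?S M k) (cobj M k) (cobj M (k + 1)) (cdiff M k) (?p M k)" for k
      by (simp add: Cmp_assoc Cmp_in_Hom Cmp_Idn_left)
    then have p: "?p M \<in> Hom (Com_minus A) (?FI M) M"
      by (simp add: in_Hom_Com_minus cobj FTot_Incl_diff[OF M])
    have "Cmp A (cobj M k) (?S M k) (?S M (k + 1))
        (Cmp A (?S M k) (cobj M (k + 1)) (?S M (k + 1)) (?i M (k + 1))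
          (Cmp A (?S M k) (cobj M k) (cobj M (k + 1)) (cdiff M k) (?p M k))) (?i M k) =
      Cmp A (cobj M k) (cobj M (k + 1)) (?S M (k + 1)) (?i M (k + 1)) (cdiff M k)" for k
      by (simp add: Cmp_assoc[symmetric] Cmp_in_Hom Cmp_Idn_right)
    then have i: "?i M \<in> Hom (Com_minus A) M (?FI M)"
      by (simp add: in_Hom_Com_minus cobj FTot_Incl_diff[OF M])
    show ?thesis
      unfolding is_iso_def
      by (intro conjI p bexI[of _ "?i M"] i)
        (simp_all add: Cmp_Com_minus Idn_Com_minus cobj axis_inj_proj[OF M])
  qed
  have nat: "Cmp (Com_minus A) (?FI M) (?FI N) N (?p N)
      (MorMap (FTot A) (ObjMap (Incl A) M) (ObjMap (Incl A) N) (MorMap (Incl A) M N g)) =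
    Cmp (Com_minus A) (?FI M) M N g (?p M)"
    if M: "M \<in> Obj (Com_minus A)" and N: "N \<in> Obj (Com_minus A)"
      and g: "g \<in> Hom (Com_minus A) M N" for M N g
  proof -
    have gk: "g k \<in> Hom A (cobj M k) (cobj N k)" for k using g by (simp add: in_Hom_Com_minus)
    note [simp] = complexD[OF M] complexD[OF N] axis_maps[OF M] axis_maps[OF N] gk
    show ?thesis
      by (rule ext) (simp add: Cmp_Com_minus cobj FTot_Incl_mor[OF M N g] Cmp_assoc Cmp_in_Hom Cmp_Idn_left)
  qed
  show ?thesis
    unfolding natural_iso_def comp_functor_def id_functor_def using iso nat by simp
qed

end

theorem theorem2:
  fixes A :: "('o, 'm) precat"
  assumes "additive_category A"
  shows "quasi_inverse_equivalences (Pyr A) (Com_minus A) (FTot A) (Incl A)"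
proof -
  interpret additive_category A by (fact assms)
  show ?thesis
    by (rule quasi_inverse_equivalencesI[OF category_Com_minus _ _ _ _ _ _ _ _ FTot_Incl_natural_iso])
      (simp_all add: in_Obj_Pyr Idn_in_Hom_Pyr FTot_Cmp FTot_obj FTot_Hom_bij FTot_Idn Incl_obj Incl_Hom)
qed

end
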